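(* Assume that the state space $S$ and all action sets $U_i$ are finite and that for every stationary control the corresponding Markov chain is irreducible. Let $\mathbf u_1\in\mathcal U_s$ be any initial stationary control and let $(\mathbf u_n)_{n\ge1}$ be generated by the policy improvement algorithm: given $\mathbf u_n$, with associated $\rho^{\mathbf u_n}$ and $h^{\mathbf u_n}$, let $\mathbf u_{n+1}\in\mathcal U_s$ be a stationary control such that for every $i\in S$, $\mathbf u_{n+1}(i)$ attains $$\min_{u\in U_i}\Bigl[\theta c(i,u)h^{\mathbf u_n}(i)+\sum_{j\in S}\lambda_{ij}(u)h^{\mathbf u_n}(j)\Bigr].$$ Then the algorithm leads to an optimal control in a finite number of steps: there exists $n\ge1$ such that $\rho^{\mathbf u_n}=\inf_{\mathbf u\in\mathcal U_s}\rho^{\mathbf u}$.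
   Context: $S=\{0,1,\dots,N\}$ is a finite state space; for each $i\in S$, $U_i$ is a finite nonempty action set; $U=\bigcup_iU_i$, $K=\{(i,u):i\in S,u\in U_i\}$. For $j\ne i$, $\lambda_{ij}:U_i\to[0,\infty)$ are given transition rates, and $\lambda_{ii}(u)=-\sum_{j\ne i}\lambda_{ij}(u)$. The running cost is $c:K\to[0,\infty)$, and $\theta\in(0,1)$. A stationary Markov control is a map $\mathbf u:S\to U$ with $\mathbf u(i)\in U_i$ for each $i$; $\mathcal U_s$ is the set of these. For $\mathbf u\in\mathcal U_s$, $\mathbb P^{\mathbf u}_i$ (expectation $\mathbb E^{\mathbf u}_i$) is the law of the continuous-time Markov chain $(X_t)_{t\ge0}$ (right-continuous paths) with $X_0=i$ and transition rates $\lambda_{ij}(\mathbf u(i))$. Let $\tau_0=\inf\{t>0:X_t=0\}$ and define $$\rho^{\mathbf u}=\lim_{T\to\infty}\frac1{\theta T}\log\mathbb E^{\mathbf u}_i\Bigl[\exp\Bigl(\theta\int_0^Tc(X_t,\mathbf u(X_t))\,dt\Bigr)\Bigr]$$ (the limit exists and does not depend on $i$), and $$h^{\mathbf u}(i)=\mathbb E^{\mathbf u}_i\Bigl[\exp\Bigl(\theta\int_0^{\tau_0}(c(X_t,\mathbf u(X_t))-\rho^{\mathbf u})\,dt\Bigr)\Bigr],\qquad i\in S.$$ A stationary control $\mathbf u$ is optimal (for the risk-sensitive average cost) if $\rho^{\mathbf u}=\inf_{\mathbf v\in\mathcal U_s}\rho^{\mathbf v}$. *)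

theory Defs
  imports "HOL-Probability.Probability"
begin

text \<open>
  States are natural numbers, the state space being \<open>S = {0..N}\<close>. A family \<open>P\<close> of probability
  measures indexed by the initial state, together with a process \<open>X\<close> with right-continuous paths
  in \<open>S\<close>, is a continuous-time Markov chain with transition rates \<open>q\<close>. The Markov property is
  multiplied out, so that it says nothing about conditioning on null events; the last clause is
  \<open>P\<^sub>i(X\<^sub>h = j) = \<delta>\<^sub>i\<^sub>j + q\<^sub>i\<^sub>j h + o(h)\<close>. Since \<open>nat\<close> carries the discrete topology,
  right-continuity means that every path stays at \<open>X\<^sub>t\<close> for some time after \<open>t\<close>.
\<close>

definition markov_chain ::
  "nat set \<Rightarrow> (nat \<Rightarrow> nat \<Rightarrow> real) \<Rightarrow> (nat \<Rightarrow> 'w measure) \<Rightarrow> (real \<Rightarrow> 'w \<Rightarrow> nat) \<Rightarrow> bool" where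
  "markov_chain S q P X \<longleftrightarrow>
    (\<forall>i\<in>S. prob_space (P i)
      \<and> (\<forall>t\<ge>0. X t \<in> measurable (P i) (count_space UNIV))
      \<and> (\<forall>\<omega>\<in>space (P i). \<forall>t\<ge>0. X t \<omega> \<in> S \<and> continuous (at_right t) (\<lambda>s. X s \<omega>))
      \<and> (AE \<omega> in P i. X 0 \<omega> = i)
      \<and> (\<forall>(n::nat) (t::nat \<Rightarrow> real) (x::nat \<Rightarrow> nat).
            0 \<le> t 0 \<and> (\<forall>k\<le>n. t k < t (Suc k)) \<and> (\<forall>k\<le>Suc n. x k \<in> S) \<longrightarrow>
            \<P>(\<omega> in P i. \<forall>k\<le>Suc n. X (t k) \<omega> = x k) =
              \<P>(\<omega> in P i. \<forall>k\<le>n. X (t k) \<omega> = x k) *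
              \<P>(\<omega> in P (x n). X (t (Suc n) - t n) \<omega> = x (Suc n)))
      \<and> (\<forall>j\<in>S. ((\<lambda>h. (\<P>(\<omega> in P i. X h \<omega> = j) - (if i = j then 1 else 0)) / h)
            \<longlongrightarrow> q i j) (at_right 0)))"

definition irreducible_chain ::
  "nat set \<Rightarrow> (nat \<Rightarrow> 'w measure) \<Rightarrow> (real \<Rightarrow> 'w \<Rightarrow> nat) \<Rightarrow> bool" where
  "irreducible_chain S P X \<longleftrightarrow> (\<forall>i\<in>S. \<forall>j\<in>S. \<exists>t\<ge>0. \<P>(\<omega> in P i. X t \<omega> = j) > 0)"

text \<open>Controls are extensional functions, so that they are determined by their values on \<open>S\<close>.\<close>

definition stationary_controls :: "nat \<Rightarrow> (nat \<Rightarrow> 'u set) \<Rightarrow> (nat \<Rightarrow> 'u) set" where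
  "stationary_controls N U = (\<Pi>\<^sub>E i\<in>{0..N}. U i)"

text \<open>
  The infimum is over the reals. On the event that \<open>0\<close> is never hit it is an unspecified constant;
  for an irreducible chain on a finite state space this event is null.
\<close>

definition hitting_time0 :: "(real \<Rightarrow> 'w \<Rightarrow> nat) \<Rightarrow> 'w \<Rightarrow> real" where
  "hitting_time0 X \<omega> = Inf {t. t > 0 \<and> X t \<omega> = 0}"

text \<open>
  In the next two definitions \<open>P\<close> is the family of laws, indexed by the initial state, of the chain
  controlled by \<open>u\<close>. \<open>rho\<close> is the common value, for all initial states, of the limit.
\<close>

definition rho ::
  "nat \<Rightarrow> real \<Rightarrow> (nat \<Rightarrow> 'u \<Rightarrow> real) \<Rightarrow> (nat \<Rightarrow> 'w measure) \<Rightarrow> (real \<Rightarrow> 'w \<Rightarrow> nat) \<Rightarrow>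
    (nat \<Rightarrow> 'u) \<Rightarrow> real" where
  "rho N \<theta> c P X u =
    (THE r. \<forall>i\<in>{0..N}.
      ((\<lambda>T. 1 / (\<theta> * T) *
          ln (LINT \<omega>|P i. exp (\<theta> * (LINT t:{0..T}|lborel. c (X t \<omega>) (u (X t \<omega>))))))
        \<longlongrightarrow> r) at_top)"

definition hfun ::
  "nat \<Rightarrow> real \<Rightarrow> (nat \<Rightarrow> 'u \<Rightarrow> real) \<Rightarrow> (nat \<Rightarrow> 'w measure) \<Rightarrow> (real \<Rightarrow> 'w \<Rightarrow> nat) \<Rightarrow>
    (nat \<Rightarrow> 'u) \<Rightarrow> nat \<Rightarrow> real" where
  "hfun N \<theta> c P X u i =
    (LINT \<omega>|P i. exp (\<theta> * (LINT t:{0..hitting_time0 X \<omega>}|lborel.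
        (c (X t \<omega>) (u (X t \<omega>)) - rho N \<theta> c P X u))))"

end

theory Submission
  imports Defs
begin

text \<open>
  For a control \<open>v\<close> let \<open>A\<^sub>v = Q\<^sub>v + \<theta> diag c\<^sub>v\<close>. This is an irreducible matrix with nonnegative
  off-diagonal entries, so it has a Perron eigenpair \<open>A\<^sub>v h = \<mu> h\<close>, \<open>h > 0\<close>, \<open>h 0 = 1\<close>. The Feynman--Kac
  formula gives \<open>\<mu> = \<theta> \<rho>\<close>; stopped at the first visit to \<open>0\<close> it gives that \<open>h\<close> is the hitting
  expectation of the policy improvement algorithm. One step replaces \<open>v\<close> by \<open>v'\<close> with
  \<open>A\<^bsub>v'\<^esub> h \<le> A\<^sub>v h = \<mu> h\<close>. If the inequality is strict somewhere, the Collatz--Wielandt comparison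
  yields \<open>\<mu>' < \<mu>\<close>, which happens only finitely often because there are finitely many controls; if it
  is an equality, then \<open>A\<^sub>w h \<ge> \<mu> h\<close> for every control \<open>w\<close>, so \<open>v\<close> is optimal.
\<close>

section \<open>Irreducible Metzler matrices\<close>

lemma continuous_on_Max:
  fixes f :: "'a \<Rightarrow> 'b::topological_space \<Rightarrow> real"
  assumes "finite S" "S \<noteq> {}" "\<And>i. i \<in> S \<Longrightarrow> continuous_on K (f i)"
  shows "continuous_on K (\<lambda>x. Max ((\<lambda>i. f i x) ` S))"
  using assms
proof (induction rule: finite_ne_induct)
  case (insert i S)
  then have "continuous_on K (\<lambda>x. max (f i x) (Max ((\<lambda>i. f i x) ` S)))"
    by (intro continuous_on_max) auto
  then show ?case using insert by (simp add: Max_insert)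
qed simp

locale metzler_matrix =
  fixes S :: "'a set" and a :: "'a \<Rightarrow> 'a \<Rightarrow> real"
  assumes finite_S: "finite S" and S_nonempty: "S \<noteq> {}"
    and offdiag_nonneg: "i \<in> S \<Longrightarrow> j \<in> S \<Longrightarrow> j \<noteq> i \<Longrightarrow> a i j \<ge> 0"
begin

definition app :: "('a \<Rightarrow> real) \<Rightarrow> 'a \<Rightarrow> real" where
  "app h i = (\<Sum>j\<in>S. a i j * h j)"

text \<open>Compare at a state where \<open>x / y\<close> is maximal: there \<open>t y - x \<ge> 0\<close> vanishes.\<close>

lemma subsolution_less_supersolution:
  assumes x: "\<And>i. i \<in> S \<Longrightarrow> x i > 0" and y: "\<And>i. i \<in> S \<Longrightarrow> y i > 0"
    and sub: "\<And>i. i \<in> S \<Longrightarrow> \<alpha> * x i \<le> app x i"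
    and super: "\<And>i. i \<in> S \<Longrightarrow> app y i < \<beta> * y i"
  shows "\<alpha> < \<beta>"
proof -
  define t where "t = Max ((\<lambda>i. x i / y i) ` S)"
  have "t \<in> (\<lambda>i. x i / y i) ` S"
    unfolding t_def using finite_S S_nonempty by (intro Max_in) auto
  then obtain i where i: "i \<in> S" "t = x i / y i" by auto
  have t: "x j \<le> t * y j" if "j \<in> S" for j
  proof -
    have "x j / y j \<le> t" unfolding t_def using finite_S that by (intro Max_ge) auto
    then show ?thesis using y[OF that] by (simp add: field_simps)
  qed
  have ti: "t * y i = x i" "t > 0" using i x[of i] y[of i] by auto
  have "0 \<le> (\<Sum>j\<in>S. a i j * (t * y j - x j))"
  proof (rule sum_nonneg)
    fix j assume j: "j \<in> S"
    show "0 \<le> a i j * (t * y j - x j)"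
      using offdiag_nonneg[OF i(1) j] t[OF j] ti by (cases "j = i") auto
  qed
  also have "\<dots> = t * app y i - app x i"
    by (simp add: app_def sum_distrib_left sum_subtractf algebra_simps)
  finally have "\<alpha> * x i \<le> t * app y i" using sub[OF i(1)] by linarith
  also have "\<dots> < t * (\<beta> * y i)" using super[OF i(1)] ti by (intro mult_strict_left_mono)
  also have "\<dots> = \<beta> * x i" using ti by (simp add: algebra_simps)
  finally show ?thesis using x[OF i(1)] by simp
qed

corollary subsolution_le_supersolution:
  assumes "\<And>i. i \<in> S \<Longrightarrow> x i > 0" and y: "\<And>i. i \<in> S \<Longrightarrow> y i > 0"
    and "\<And>i. i \<in> S \<Longrightarrow> \<alpha> * x i \<le> app x i"
    and super: "\<And>i. i \<in> S \<Longrightarrow> app y i \<le> \<beta> * y i"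
  shows "\<alpha> \<le> \<beta>"
proof (rule field_le_epsilon)
  fix e :: real assume "e > 0"
  have "app y i < (\<beta> + e) * y i" if "i \<in> S" for i
    using super[OF that] mult_pos_pos[OF \<open>e > 0\<close> y[OF that]] by (simp add: algebra_simps)
  then show "\<alpha> \<le> \<beta> + e"
    using subsolution_less_supersolution[OF assms(1,2,3)] by (simp add: less_imp_le)
qed

end

locale irreducible_metzler_matrix = metzler_matrix +
  assumes irreducible: "D \<subseteq> S \<Longrightarrow> D \<noteq> {} \<Longrightarrow> D \<noteq> S \<Longrightarrow> \<exists>j\<in>S - D. \<exists>i\<in>D. a j i > 0"
begin

text \<open>Lowering \<open>h\<close> slightly at a state \<open>i\<close> of \<open>D\<close> makes the inequality strict at every \<open>j\<close> with
  \<open>a j i > 0\<close>, so the set of strict inequalities can be enlarged until it is everything. On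
  \<open>Z\<close> no inequality is required.\<close>

lemma strict_supersolution:
  assumes "D \<subseteq> S" "D \<noteq> {}" "Z \<subseteq> D" "\<And>i. i \<in> S \<Longrightarrow> h i > 0"
    and "\<And>i. i \<in> D - Z \<Longrightarrow> app h i < \<mu> * h i" and "\<And>i. i \<in> S - D \<Longrightarrow> app h i \<le> \<mu> * h i"
  shows "\<exists>w. (\<forall>i\<in>S. w i > 0) \<and> (\<forall>i\<in>S - Z. app w i < \<mu> * w i)"
  using assms
proof (induction "card (S - D)" arbitrary: D h rule: less_induct)
  case less
  note D = less.prems(1-3) and h = less.prems(4) and strict = less.prems(5) and weak = less.prems(6)
  show ?case
  proof (cases "D = S")
    case True
    then show ?thesis using h strict by blast
  next
    case False
    then obtain i j where ij: "j \<in> S - D" "i \<in> D" "a j i > 0"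
      using irreducible[OF D(1,2)] by blast
    then have i: "i \<in> S" using D by auto
    define gap where "gap = (if i \<in> Z then 1 else \<mu> * h i - app h i)"
    have gap: "gap > 0" using strict[of i] ij by (auto simp: gap_def)
    define e where "e = min (h i / 2) (gap / (2 * (\<bar>a i i - \<mu>\<bar> + 1)))"
    have "gap / (2 * (\<bar>a i i - \<mu>\<bar> + 1)) > 0" using gap by (intro divide_pos_pos mult_pos_pos add_nonneg_pos) simp_all
    then have e: "e > 0" "e < h i" using h[OF i] by (auto simp: e_def min_less_iff_disj)
    have "e * \<bar>a i i - \<mu>\<bar> < gap"
    proof -
      have "e * \<bar>a i i - \<mu>\<bar> \<le> gap / (2 * (\<bar>a i i - \<mu>\<bar> + 1)) * \<bar>a i i - \<mu>\<bar>"
        by (intro mult_right_mono) (auto simp: e_def)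
      also have "\<dots> < gap" using gap by (simp add: field_simps add_pos_nonneg)
      finally show ?thesis .
    qed
    then have egap: "- (a i i * e) + \<mu> * e < gap"
      using mult_left_mono[OF abs_ge_minus_self[of "a i i - \<mu>"] less_imp_le[OF e(1)]] by (simp add: algebra_simps)
    define w where "w = h(i := h i - e)"
    have app_w: "app w l = app h l - a l i * e" for l
    proof -
      have "app w l = (\<Sum>k\<in>S. a l k * h k - (if k = i then a l i * e else 0))"
        unfolding app_def by (intro sum.cong) (auto simp: w_def algebra_simps)
      then show ?thesis using i finite_S by (simp add: app_def sum_subtractf)
    qed
    have dec: "app w l \<le> app h l" if "l \<in> S" "l \<noteq> i" for l
      using offdiag_nonneg[of l i] that i e unfolding app_w by auto
    show ?thesis
    proof (rule less.hyps[of "insert j D" w])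
      show "card (S - insert j D) < card (S - D)"
        using ij finite_S by (intro psubset_card_mono) auto
      show "0 < w l" if "l \<in> S" for l using h[OF that] e by (auto simp: w_def)
      show "app w l < \<mu> * w l" if l: "l \<in> insert j D - Z" for l
      proof (cases "l = j")
        case True
        have "app w j < app h j" unfolding app_w using ij e by simp
        then show ?thesis using weak[OF ij(1)] True ij by (auto simp: w_def)
      next
        case False
        show ?thesis
        proof (cases "l = i")
          case True
          then have "i \<notin> Z" using l by auto
          then show ?thesis using True egap unfolding app_w by (simp add: w_def gap_def algebra_simps)
        next
          case False
          then have "l \<in> D - Z" using l \<open>l \<noteq> j\<close> by auto
          then show ?thesis using strict[of l] dec[of l] False D by (auto simp: w_def)
        qed
      qed
      show "app w l \<le> \<mu> * w l" if l: "l \<in> S - insert j D" for l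
        using weak[of l] dec[of l] l ij by (auto simp: w_def)
    qed (use D ij in auto)
  qed
qed

lemma supersolution_harnack:
  obtains \<kappa> where "\<kappa> > 0"
    "\<And>h i j. (\<And>k. k \<in> S \<Longrightarrow> h k > 0) \<Longrightarrow> (\<And>k. k \<in> S \<Longrightarrow> app h k \<le> \<mu> * h k) \<Longrightarrow>
      i \<in> S \<Longrightarrow> j \<in> S \<Longrightarrow> \<kappa> * h i \<le> h j"
proof -
  define super where
    "super h \<longleftrightarrow> (\<forall>k\<in>S. h k > 0) \<and> (\<forall>k\<in>S. app h k \<le> \<mu> * h k)" for h
  have grow: "\<exists>D \<kappa>. i \<in> D \<and> D \<subseteq> S \<and> card D = Suc n \<and> \<kappa> > 0 \<and> (\<forall>h. super h \<longrightarrow> (\<forall>j\<in>D. \<kappa> * h i \<le> h j))"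
    if i: "i \<in> S" and "Suc n \<le> card S" for i n
    using that(2)
  proof (induction n)
    case 0
    show ?case by (rule exI[of _ "{i}"], rule exI[of _ 1]) (use i in auto)
  next
    case (Suc n)
    then obtain D \<kappa> where D: "i \<in> D" "D \<subseteq> S" "card D = Suc n" "\<kappa> > 0"
      and \<kappa>: "\<And>h j. super h \<Longrightarrow> j \<in> D \<Longrightarrow> \<kappa> * h i \<le> h j" by auto
    have "D \<noteq> S" using D Suc.prems by auto
    then obtain l j where lj: "j \<in> S - D" "l \<in> D" "a j l > 0"
      using irreducible[of D] D by blast
    define c where "c = a j l / (\<bar>\<mu> - a j j\<bar> + 1)"
    have c: "c > 0" using lj by (simp add: c_def)
    have step: "c * h l \<le> h j" if h: "super h" for h
    proof -
      have pos: "h k > 0" if "k \<in> S" for k using h that by (auto simp: super_def)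
      have "a j j * h j + a j l * h l = (\<Sum>k\<in>{j, l}. a j k * h k)"
        using lj by (subst sum.insert) auto
      also have "\<dots> \<le> app h j"
        unfolding app_def
      proof (rule sum_mono2)
        fix k assume "k \<in> S - {j, l}"
        then show "0 \<le> a j k * h k" using offdiag_nonneg[of j k] pos[of k] lj by auto
      qed (use finite_S lj D in auto)
      also have "\<dots> \<le> \<mu> * h j" using h lj by (auto simp: super_def)
      finally have "a j l * h l \<le> (\<mu> - a j j) * h j" by (simp add: algebra_simps)
      also have "\<dots> \<le> (\<bar>\<mu> - a j j\<bar> + 1) * h j"
        using pos[of j] lj by (intro mult_right_mono) auto
      finally show ?thesis by (simp add: c_def field_simps add_nonneg_pos)
    qed
    have "min \<kappa> (c * \<kappa>) * h i \<le> h k" if h: "super h" and k: "k \<in> insert j D" for h k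
    proof -
      have hi: "h i > 0" using h i by (auto simp: super_def)
      show ?thesis
      proof (cases "k = j")
        case True
        have "min \<kappa> (c * \<kappa>) * h i \<le> c * \<kappa> * h i" using hi by (intro mult_right_mono) auto
        also have "\<dots> \<le> c * h l" using \<kappa>[OF h lj(2)] c by simp
        also have "\<dots> \<le> h j" by (rule step[OF h])
        finally show ?thesis using True by simp
      next
        case False
        have "min \<kappa> (c * \<kappa>) * h i \<le> \<kappa> * h i" using hi by (intro mult_right_mono) auto
        also have "\<dots> \<le> h k" using \<kappa>[OF h] False k by auto
        finally show ?thesis .
      qed
    qed
    moreover have "card (insert j D) = Suc (Suc n)"
      using D lj finite_S by (simp add: finite_subset)
    ultimately show ?case
      using D lj c by (intro exI[of _ "insert j D"] exI[of _ "min \<kappa> (c * \<kappa>)"]) auto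
  qed
  have "\<exists>\<kappa>>0. \<forall>h. super h \<longrightarrow> (\<forall>j\<in>S. \<kappa> * h i \<le> h j)" if i: "i \<in> S" for i
  proof -
    have "card S > 0" using finite_S S_nonempty by (simp add: card_gt_0_iff)
    then obtain D \<kappa> where "D \<subseteq> S" "card D = card S" "\<kappa> > 0" "\<forall>h. super h \<longrightarrow> (\<forall>j\<in>D. \<kappa> * h i \<le> h j)"
      using grow[OF i, of "card S - 1"] by auto
    then show ?thesis using card_subset_eq[OF finite_S] by blast
  qed
  then obtain K where K: "\<And>i. i \<in> S \<Longrightarrow> K i > 0"
    "\<And>i h j. i \<in> S \<Longrightarrow> super h \<Longrightarrow> j \<in> S \<Longrightarrow> K i * h i \<le> h j" by metis
  show ?thesis
  proof (rule that[of "Min (K ` S)"])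
    show "Min (K ` S) > 0" using K finite_S S_nonempty by simp
    fix h i j assume h: "\<And>k. k \<in> S \<Longrightarrow> h k > 0" "\<And>k. k \<in> S \<Longrightarrow> app h k \<le> \<mu> * h k"
      and ij: "i \<in> S" "j \<in> S"
    have "Min (K ` S) * h i \<le> K i * h i"
      using h(1)[OF ij(1)] ij finite_S by (intro mult_right_mono) auto
    also have "\<dots> \<le> h j" using K(2)[OF ij(1) _ ij(2)] h by (auto simp: super_def)
    finally show "Min (K ` S) * h i \<le> h j" .
  qed
qed

text \<open>Perron--Frobenius by minimising \<open>max\<^sub>i (a h)\<^sub>i / h\<^sub>i\<close>, which the Harnack inequality confines
  to a compact set: a minimiser with a strict inequality could be improved.\<close>

theorem perron_eigenvector:
  assumes z: "z \<in> S"
  obtains \<mu> h where "h z = 1" "\<And>i. i \<in> S \<Longrightarrow> h i > 0" "\<And>i. i \<in> S \<Longrightarrow> app h i = \<mu> * h i"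
proof -
  define G where "G h = Max ((\<lambda>i. app h i / h i) ` S)" for h
  have G_le: "app h i \<le> G h * h i" if "h i > 0" "i \<in> S" for h i
  proof -
    have "app h i / h i \<le> G h" unfolding G_def using finite_S that by (intro Max_ge) auto
    then show ?thesis using that by (simp add: field_simps)
  qed
  define \<mu>1 where "\<mu>1 = G (\<lambda>_. 1)"
  obtain \<kappa> where \<kappa>: "\<kappa> > 0" and harnack:
    "\<And>h i j. (\<And>k. k \<in> S \<Longrightarrow> h k > 0) \<Longrightarrow> (\<And>k. k \<in> S \<Longrightarrow> app h k \<le> \<mu>1 * h k) \<Longrightarrow>
      i \<in> S \<Longrightarrow> j \<in> S \<Longrightarrow> \<kappa> * h i \<le> h j"
    using supersolution_harnack[of \<mu>1] by blast
  have \<kappa>1: "\<kappa> \<le> 1"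
    using harnack[of "\<lambda>_. 1" z z] z G_le[of "\<lambda>_. 1"] by (simp add: \<mu>1_def)
  define K where "K = PiE UNIV (\<lambda>i. if i \<in> S then {\<kappa>..1 / \<kappa>} else {1})"
  have K_pos: "h i > 0" if "i \<in> S" "h \<in> K" for i h
  proof -
    have "h i \<in> (if i \<in> S then {\<kappa>..1 / \<kappa>} else {1})"
      using that(2) unfolding K_def by (rule PiE_mem) simp
    then show ?thesis using \<kappa> that by simp
  qed
  have "compactin (product_topology (\<lambda>_. euclidean) UNIV) K"
    unfolding K_def by (subst compactin_PiE) auto
  then have "compact K"
    by (simp add: euclidean_product_topology)
  moreover have one: "(\<lambda>_. 1) \<in> K" using \<kappa> \<kappa>1 by (auto simp: K_def)
  moreover have "continuous_on K G"
    unfolding G_def app_def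
  proof (rule continuous_on_Max[OF finite_S S_nonempty])
    fix i assume i: "i \<in> S"
    have coord: "continuous_on K (\<lambda>h. h j)" for j
      by (rule continuous_on_subset[OF continuous_on_product_coordinates]) simp
    show "continuous_on K (\<lambda>h. (\<Sum>j\<in>S. a i j * h j) / h i)"
      by (intro continuous_on_divide continuous_on_sum continuous_on_mult continuous_on_const coord ballI)
         (use K_pos i in force)
  qed
  ultimately obtain h0 where h0: "h0 \<in> K" "\<And>h. h \<in> K \<Longrightarrow> G h0 \<le> G h"
    using continuous_attains_inf[of K G] by blast
  have pos: "h0 i > 0" if "i \<in> S" for i by (rule K_pos[OF that h0(1)])
  have "app h0 i = G h0 * h0 i" if i: "i \<in> S" for i
  proof (rule ccontr)
    assume "app h0 i \<noteq> G h0 * h0 i"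
    then have "app h0 i < G h0 * h0 i" using G_le[of h0 i] pos[OF i] i by simp
    then have "\<exists>w. (\<forall>i\<in>S. w i > 0) \<and> (\<forall>i\<in>S - {}. app w i < G h0 * w i)"
      using pos G_le i by (intro strict_supersolution[of "{i}" "{}" h0 "G h0"]) auto
    then obtain w where w: "\<And>i. i \<in> S \<Longrightarrow> w i > 0" "\<And>i. i \<in> S \<Longrightarrow> app w i < G h0 * w i"
      by (metis Diff_empty)
    define w' where "w' i = (if i \<in> S then w i / w z else 1)" for i
    have app': "app w' i = app w i / w z" for i
      unfolding app_def w'_def by (simp add: sum_divide_distrib)
    have w': "w' i > 0" "app w' i < G h0 * w' i" if "i \<in> S" for i
      using w(1)[OF that] w(2)[OF that] w(1)[OF z] that by (auto simp: app' w'_def field_simps)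
    have "G h0 \<le> \<mu>1" unfolding \<mu>1_def using h0(2)[OF one] .
    then have sup: "app w' i \<le> \<mu>1 * w' i" if "i \<in> S" for i
      using w'[OF that] mult_right_mono[of "G h0" \<mu>1 "w' i"] by linarith
    have har: "\<kappa> * w' i \<le> w' j" if "i \<in> S" "j \<in> S" for i j
      using harnack[of w'] w'(1) sup that by blast
    have "w' z = 1" using z w(1)[OF z] by (simp add: w'_def)
    then have "w' i \<in> {\<kappa>..1 / \<kappa>}" if "i \<in> S" for i
      using har[OF that z] har[OF z that] \<kappa> by (simp add: field_simps)
    then have "w' \<in> K" by (auto simp: K_def w'_def)
    then have "G h0 \<le> G w'" by (rule h0)
    moreover have "G w' < G h0"
      unfolding G_def[of w'] using w' finite_S S_nonempty by (subst Max_less_iff) (auto simp: field_simps)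
    ultimately show False by simp
  qed
  then show ?thesis
    using pos less_imp_neq[OF pos[OF z]] z
    by (intro that[of "\<lambda>i. h0 i / h0 z" "G h0"]) (auto simp: app_def sum_divide_distrib[symmetric])
qed

end

section \<open>Integrals along right-continuous paths\<close>

lemma right_continuous_nat_stays:
  fixes x :: "real \<Rightarrow> nat"
  assumes "continuous (at_right t) x"
  obtains e where "e > 0" "\<And>s. t \<le> s \<Longrightarrow> s < t + e \<Longrightarrow> x s = x t"
proof -
  have "(x \<longlongrightarrow> x t) (at_right t)"
    using assms by (simp add: continuous_within)
  then have "eventually (\<lambda>s. x s \<in> {x t}) (at_right t)"
    by (rule topological_tendstoD) (simp_all add: discrete_topology_class.open_discrete)
  then obtain b where b: "b > t" "\<And>y. y > t \<Longrightarrow> y < b \<Longrightarrow> x y = x t"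
    unfolding eventually_at_right_field by auto
  show ?thesis
  proof (rule that[of "b - t"])
    show "x s = x t" if "t \<le> s" "s < t + (b - t)" for s
      using b(2)[of s] that by (cases "s = t") auto
  qed (use b in auto)
qed

lemma integral_step_function:
  fixes f :: "nat \<Rightarrow> real" and d :: real
  assumes d: "d > 0"
  shows "(LINT t:{0..real n * d}|lborel. f (nat \<lceil>t / d\<rceil>)) = (\<Sum>l<n. d * f (Suc l))"
proof -
  have ind: "indicator {0..real n * d} t * f (nat \<lceil>t / d\<rceil>) =
      (\<Sum>l<n. f (Suc l) * indicator {real l * d<..real (Suc l) * d} t)" if "t \<noteq> 0" for t :: real
  proof (cases "t > 0")
    case True
    define m where "m = nat \<lceil>t / d\<rceil>"
    have m: "m \<ge> 1" "real m - 1 < t / d" "t / d \<le> real m"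
      using True d unfolding m_def by (auto simp: Suc_le_eq) linarith+
    have *: "indicator {real l * d<..real (Suc l) * d} t = (if Suc l = m then 1 else 0::real)" for l
    proof -
      have "t \<in> {real l * d<..real (Suc l) * d} \<longleftrightarrow> real l < t / d \<and> t / d \<le> real (Suc l)"
        using d by (simp add: field_simps)
      also have "\<dots> \<longleftrightarrow> Suc l = m"
        using m by auto
      finally show ?thesis by (simp add: indicator_def)
    qed
    have **: "t \<in> {0..real n * d} \<longleftrightarrow> m \<le> n"
    proof -
      have "t \<in> {0..real n * d} \<longleftrightarrow> t / d \<le> real n"
        using d True by (simp add: field_simps)
      also have "\<dots> \<longleftrightarrow> m \<le> n"
        using m by linarith
      finally show ?thesis .
    qed
    obtain m' where m': "m = Suc m'" using m(1) by (cases m) auto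
    show ?thesis
      unfolding * m_def[symmetric] using ** m'
      by (auto simp: indicator_def if_distrib cong: if_cong)
  next
    case False
    have "indicator {real l * d<..real (Suc l) * d} t = (0::real)" for l
    proof -
      have "real l * d \<ge> 0" using d by simp
      then show ?thesis using False by (auto simp: indicator_def)
    qed
    with False that show ?thesis by simp
  qed
  have "(LINT t:{0..real n * d}|lborel. f (nat \<lceil>t / d\<rceil>)) =
      (LINT t|lborel. (\<Sum>l<n. f (Suc l) * indicator {real l * d<..real (Suc l) * d} t))"
    unfolding set_lebesgue_integral_def
  proof (intro integral_cong_AE)
    show "AE t in lborel. indicator {0..real n * d} t *\<^sub>R f (nat \<lceil>t / d\<rceil>) =
      (\<Sum>l<n. f (Suc l) * indicator {real l * d<..real (Suc l) * d} t)"
      using AE_lborel_singleton[of "0::real"] by eventually_elim (use ind in auto)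
  qed measurable
  also have "\<dots> = (\<Sum>l<n. LINT t|lborel. f (Suc l) * indicator {real l * d<..real (Suc l) * d} t)"
    by (intro Bochner_Integration.integral_sum integrable_mult_right integrable_real_indicator)
      (use d in \<open>simp_all add: algebra_simps\<close>)
  also have "\<dots> = (\<Sum>l<n. d * f (Suc l))"
    using d by (intro sum.cong) (auto simp: algebra_simps)
  finally show ?thesis .
qed

definition survives :: "(real \<Rightarrow> nat) \<Rightarrow> nat set \<Rightarrow> real \<Rightarrow> bool" where
  "survives x Z t \<longleftrightarrow> (\<forall>s\<in>{0..t}. x s \<notin> Z)"

definition action :: "(real \<Rightarrow> nat) \<Rightarrow> nat set \<Rightarrow> (nat \<Rightarrow> real) \<Rightarrow> real \<Rightarrow> real" where
  "action x Z F T = (LINT t:{0..T}|lborel. if survives x Z t then F (x t) else 0)"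

definition grid_survives :: "(nat \<Rightarrow> nat) \<Rightarrow> nat set \<Rightarrow> nat \<Rightarrow> bool" where
  "grid_survives y Z k \<longleftrightarrow> (\<forall>j\<le>k. y j \<notin> Z)"

definition grid_action :: "real \<Rightarrow> (nat \<Rightarrow> nat) \<Rightarrow> nat set \<Rightarrow> (nat \<Rightarrow> real) \<Rightarrow> nat \<Rightarrow> real" where
  "grid_action d y Z F k = (\<Sum>l<k. d * (if grid_survives y Z (Suc l) then F (y (Suc l)) else 0))"

lemma eventually_grid_matches:
  fixes x :: "real \<Rightarrow> nat"
  assumes cont: "\<And>t. t \<ge> 0 \<Longrightarrow> continuous (at_right t) x"
    and t: "t \<ge> 0" and d0: "d \<longlonglongrightarrow> 0" and d: "\<And>n. d n > 0"
  shows "\<forall>\<^sub>F n in sequentially. x (real (nat \<lceil>t / d n\<rceil>) * d n) = x t \<and>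
    (grid_survives (\<lambda>l. x (real l * d n)) Z (nat \<lceil>t / d n\<rceil>) \<longleftrightarrow> survives x Z t)"
proof -
  have near: "s \<le> real (nat \<lceil>s / d n\<rceil>) * d n \<and> real (nat \<lceil>s / d n\<rceil>) * d n < s + d n"
    if "s \<ge> 0" for s n
  proof -
    have "s / d n \<ge> 0" using that d[of n] by simp
    then have "real (nat \<lceil>s / d n\<rceil>) = of_int \<lceil>s / d n\<rceil>" by simp
    then have "s / d n \<le> real (nat \<lceil>s / d n\<rceil>)" "real (nat \<lceil>s / d n\<rceil>) < s / d n + 1"
      by linarith+
    then show ?thesis using d[of n] by (simp add: field_simps)
  qed
  have ev: "\<forall>\<^sub>F n in sequentially. x (real (nat \<lceil>s / d n\<rceil>) * d n) = x s" if s: "s \<ge> 0" for s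
  proof -
    obtain e where e: "e > 0" "\<And>r. s \<le> r \<Longrightarrow> r < s + e \<Longrightarrow> x r = x s"
      using right_continuous_nat_stays[OF cont[OF s]] by blast
    from d0 e(1) have "\<forall>\<^sub>F n in sequentially. d n < e" by (rule order_tendstoD)
    then show ?thesis
      by eventually_elim (use near[OF s] e(2) in force)
  qed
  show ?thesis
  proof (cases "survives x Z t")
    case True
    from ev[OF t] show ?thesis
    proof eventually_elim
      case (elim n)
      have "x (real j * d n) \<notin> Z" if j: "j \<le> nat \<lceil>t / d n\<rceil>" for j
      proof (cases "j = nat \<lceil>t / d n\<rceil>")
        case True
        then show ?thesis using \<open>survives x Z t\<close> t elim by (auto simp: survives_def)
      next
        case False
        with j have "real j < t / d n" by linarith
        then have "real j * d n \<in> {0..t}" using d[of n] by (simp add: field_simps)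
        then show ?thesis using \<open>survives x Z t\<close> by (auto simp: survives_def)
      qed
      then show ?case using True elim by (auto simp: grid_survives_def)
    qed
  next
    case False
    then obtain s where s: "s \<in> {0..t}" "x s \<in> Z" by (auto simp: survives_def)
    have "\<forall>\<^sub>F n in sequentially. x (real (nat \<lceil>s / d n\<rceil>) * d n) = x s" using ev s by auto
    with ev[OF t] show ?thesis
    proof eventually_elim
      case (elim n)
      have "nat \<lceil>s / d n\<rceil> \<le> nat \<lceil>t / d n\<rceil>"
        using s d[of n] by (intro nat_mono ceiling_mono divide_right_mono) auto
      then have "\<not> grid_survives (\<lambda>l. x (real l * d n)) Z (nat \<lceil>t / d n\<rceil>)"
        using elim s unfolding grid_survives_def by metis
      then show ?case using elim False by blast
    qed
  qed
qed

text \<open>The sums are taken at right end points, so that right-continuity alone suffices for the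
  convergence; no bound on the number of jumps is needed.\<close>

lemma grid_action_tendsto:
  fixes x :: "real \<Rightarrow> nat"
  assumes cont: "\<And>t. t \<ge> 0 \<Longrightarrow> continuous (at_right t) x"
    and bnd: "\<And>t. t \<ge> 0 \<Longrightarrow> \<bar>F (x t)\<bar> \<le> B" and T: "T > 0"
  shows "(\<lambda>n. grid_action (T / real (Suc n)) (\<lambda>l. x (real l * (T / real (Suc n)))) Z F (Suc n))
           \<longlonglongrightarrow> action x Z F T"
    and "\<forall>\<^sub>F n in sequentially. grid_survives (\<lambda>l. x (real l * (T / real (Suc n)))) Z (Suc n)
           \<longleftrightarrow> survives x Z T"
    and "set_integrable lborel {0..T} (\<lambda>t. if survives x Z t then F (x t) else 0)"
proof -
  define d where "d n = T / real (Suc n)" for n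
  have d: "d n > 0" for n using T by (simp add: d_def)
  have d0: "d \<longlonglongrightarrow> 0" unfolding d_def using LIMSEQ_Suc[OF lim_const_over_n[of T]] by simp
  have dT: "T / d n = real (Suc n)" "real (Suc n) * d n = T" for n
    using T by (simp_all add: d_def)
  have "B \<ge> 0" using bnd[of 0] by linarith
  define y where "y n l = x (real l * d n)" for n l
  define f where "f n l = (if grid_survives (y n) Z l then F (y n l) else 0)" for n l
  define g where "g t = (if survives x Z t then F (x t) else 0)" for t
  have fB: "\<bar>f n l\<bar> \<le> B" for n l
    using bnd[of "real l * d n"] d[of n] \<open>B \<ge> 0\<close> by (auto simp: f_def y_def)
  have lim: "(\<lambda>n. indicator {0..T} t *\<^sub>R f n (nat \<lceil>t / d n\<rceil>)) \<longlonglongrightarrow> indicator {0..T} t *\<^sub>R g t" for t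
  proof (cases "t \<in> {0..T}")
    case True
    have "\<forall>\<^sub>F n in sequentially. f n (nat \<lceil>t / d n\<rceil>) = g t"
      using eventually_grid_matches[OF cont _ d0 d, of t Z] True
      by (auto elim!: eventually_mono simp: f_def g_def y_def[abs_def])
    then show ?thesis using True by (auto intro: tendsto_eventually)
  qed auto
  have meas: "(\<lambda>t. indicator {0..T} t *\<^sub>R f n (nat \<lceil>t / d n\<rceil>)) \<in> borel_measurable lborel" for n
    by measurable
  have measg: "(\<lambda>t. indicator {0..T} t *\<^sub>R g t) \<in> borel_measurable lborel"
    by (rule borel_measurable_LIMSEQ_real[OF lim meas])
  have intB: "integrable lborel (\<lambda>t. B * indicator {0..T} t)"
    by (intro integrable_mult_right integrable_real_indicator) (use T in \<open>simp_all\<close>)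
  have bd: "norm (indicator {0..T} t *\<^sub>R f n (nat \<lceil>t / d n\<rceil>)) \<le> B * indicator {0..T} t" for n t
    using fB[of n "nat \<lceil>t / d n\<rceil>"] by (auto simp: indicator_def)
  have "(\<lambda>n. LINT t|lborel. indicator {0..T} t *\<^sub>R f n (nat \<lceil>t / d n\<rceil>))
     \<longlonglongrightarrow> (LINT t|lborel. indicator {0..T} t *\<^sub>R g t)"
    by (rule integral_dominated_convergence[OF measg meas intB]) (use lim bd in auto)
  moreover have "(LINT t|lborel. indicator {0..T} t *\<^sub>R f n (nat \<lceil>t / d n\<rceil>)) =
      grid_action (d n) (y n) Z F (Suc n)" for n
    using integral_step_function[OF d[of n], of "Suc n" "f n"] unfolding dT
    by (simp add: set_lebesgue_integral_def grid_action_def f_def del: sum.lessThan_Suc)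
  ultimately show "(\<lambda>n. grid_action (T / real (Suc n)) (\<lambda>l. x (real l * (T / real (Suc n)))) Z F (Suc n))
           \<longlonglongrightarrow> action x Z F T"
    by (simp add: action_def set_lebesgue_integral_def g_def[symmetric] d_def[symmetric] y_def[symmetric] del: of_nat_Suc)
  show "\<forall>\<^sub>F n in sequentially. grid_survives (\<lambda>l. x (real l * (T / real (Suc n)))) Z (Suc n)
           \<longleftrightarrow> survives x Z T"
    using eventually_grid_matches[OF cont _ d0 d, of T Z] T unfolding dT
    by (auto elim!: eventually_mono simp: d_def simp del: of_nat_Suc)
  show "set_integrable lborel {0..T} (\<lambda>t. if survives x Z t then F (x t) else 0)"
    unfolding set_integrable_def g_def[symmetric]
  proof (rule Bochner_Integration.integrable_bound[OF intB measg], rule AE_I2)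
    fix t
    show "norm (indicator {0..T} t *\<^sub>R g t) \<le> norm (B * indicator {0..T} t)"
      using bnd[of t] \<open>B \<ge> 0\<close> by (auto simp: indicator_def g_def)
  qed
qed

definition grid_payoff ::
  "real \<Rightarrow> (nat \<Rightarrow> nat) \<Rightarrow> nat set \<Rightarrow> (nat \<Rightarrow> real) \<Rightarrow> (nat \<Rightarrow> real) \<Rightarrow> nat \<Rightarrow> real" where
  "grid_payoff d y Z F h k =
    exp (grid_action d y Z F k) * (if grid_survives y Z k then h (y k) else h 0)"

text \<open>The killing set \<open>Z\<close> is only ever \<open>{}\<close> or \<open>{0}\<close>, hence the terminal value \<open>h 0\<close> after killing.\<close>

definition payoff ::
  "(real \<Rightarrow> nat) \<Rightarrow> nat set \<Rightarrow> (nat \<Rightarrow> real) \<Rightarrow> (nat \<Rightarrow> real) \<Rightarrow> real \<Rightarrow> real" where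
  "payoff x Z F h T = exp (action x Z F T) * (if survives x Z T then h (x T) else h 0)"

lemma grid_survives_cong:
  "(\<And>j. j \<le> k \<Longrightarrow> y j = z j) \<Longrightarrow> grid_survives y Z k = grid_survives z Z k"
  by (auto simp: grid_survives_def)

lemma grid_action_cong:
  assumes "\<And>j. j \<le> k \<Longrightarrow> y j = z j"
  shows "grid_action d y Z F k = grid_action d z Z F k"
  unfolding grid_action_def
proof (intro sum.cong refl)
  fix l assume l: "l \<in> {..<k}"
  then have "grid_survives y Z (Suc l) = grid_survives z Z (Suc l)"
    by (intro grid_survives_cong assms) auto
  with l assms[of "Suc l"] show "d * (if grid_survives y Z (Suc l) then F (y (Suc l)) else 0) =
      d * (if grid_survives z Z (Suc l) then F (z (Suc l)) else 0)" by auto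
qed

lemma grid_survives_Suc: "grid_survives y Z (Suc k) \<longleftrightarrow> grid_survives y Z k \<and> y (Suc k) \<notin> Z"
  by (auto simp: grid_survives_def le_Suc_eq)

lemma grid_payoff_Suc:
  "grid_payoff d y Z F h (Suc k) =
    (if grid_survives y Z k
     then exp (grid_action d y Z F k) *
       (if y (Suc k) \<in> Z then h 0 else exp (d * F (y (Suc k))) * h (y (Suc k)))
     else grid_payoff d y Z F h k)"
  by (auto simp: grid_payoff_def grid_survives_Suc grid_action_def exp_add)

lemma abs_grid_action_le:
  assumes "d \<ge> 0" "\<And>l. \<bar>F (y l)\<bar> \<le> B"
  shows "\<bar>grid_action d y Z F k\<bar> \<le> real k * d * B"
proof -
  have "B \<ge> 0" using assms(2)[of 0] by linarith
  have "\<bar>grid_action d y Z F k\<bar> \<le>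
      (\<Sum>l<k. \<bar>d * (if grid_survives y Z (Suc l) then F (y (Suc l)) else 0)\<bar>)"
    unfolding grid_action_def by (rule sum_abs)
  also have "\<dots> \<le> (\<Sum>l<k. d * B)"
    using assms \<open>B \<ge> 0\<close> by (intro sum_mono) (auto simp: abs_mult intro!: mult_left_mono)
  finally show ?thesis by (simp add: mult.assoc)
qed

lemma survives_empty [simp]: "survives x {} T"
  by (simp add: survives_def)

lemma survives_mono: "survives x Z T' \<Longrightarrow> T \<le> T' \<Longrightarrow> survives x Z T"
  by (auto simp: survives_def)

lemma action_after_death:
  assumes "\<not> survives x Z T" "T \<le> T'"
  shows "action x Z F T' = action x Z F T"
  unfolding action_def set_lebesgue_integral_def
proof (rule Bochner_Integration.integral_cong[OF refl])
  fix t
  show "indicator {0..T'} t *\<^sub>R (if survives x Z t then F (x t) else 0) =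
      indicator {0..T} t *\<^sub>R (if survives x Z t then F (x t) else 0)"
    using assms survives_mono[of x Z t T] by (auto simp: indicator_def)
qed

lemma survives_iff_less_hitting_time:
  fixes x :: "real \<Rightarrow> nat"
  assumes cont: "\<And>t. t \<ge> 0 \<Longrightarrow> continuous (at_right t) x"
    and hit: "{t. t > 0 \<and> x t = 0} \<noteq> {}" and t: "t \<ge> 0"
  shows "survives x {0} t \<longleftrightarrow> t < Inf {t. t > 0 \<and> x t = 0}"
    and "Inf {t. t > 0 \<and> x t = 0} \<ge> 0"
proof -
  define H where "H = {t. t > 0 \<and> x t = 0}"
  have bdd: "bdd_below H" by (rule bdd_belowI[of _ 0]) (auto simp: H_def)
  have H: "H \<noteq> {}" using hit by (simp add: H_def)
  have Inf0: "Inf H \<ge> 0" by (rule cInf_greatest[OF H]) (auto simp: H_def)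
  have "x (Inf H) = 0"
  proof (rule ccontr)
    assume ne: "x (Inf H) \<noteq> 0"
    obtain e where e: "e > 0" "\<And>s. Inf H \<le> s \<Longrightarrow> s < Inf H + e \<Longrightarrow> x s = x (Inf H)"
      using right_continuous_nat_stays[OF cont[OF Inf0]] by blast
    have "Inf H + e \<le> Inf H"
    proof (rule cInf_greatest[OF H])
      fix s assume s: "s \<in> H"
      then have "Inf H \<le> s" using bdd by (rule cInf_lower)
      then show "Inf H + e \<le> s" using e(2)[of s] ne s by (cases "s < Inf H + e") (auto simp: H_def)
    qed
    with e show False by simp
  qed
  moreover have "s \<ge> Inf H" if s: "s \<ge> 0" "x s = 0" for s
  proof (cases "s = 0")
    case True
    obtain e where e: "e > 0" "\<And>r. 0 \<le> r \<Longrightarrow> r < 0 + e \<Longrightarrow> x r = x 0"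
      using right_continuous_nat_stays[OF cont[OF order_refl]] by blast
    have "Inf H \<le> 0 + d" if "d > 0" for d
    proof -
      have "min d (e / 2) \<in> H" using e(1) e(2)[of "min d (e / 2)"] that s True by (auto simp: H_def min_def)
      then have "Inf H \<le> min d (e / 2)" using bdd by (rule cInf_lower)
      then show ?thesis by simp
    qed
    then have "Inf H \<le> 0" by (rule field_le_epsilon)
    then show ?thesis using True by simp
  next
    case False
    then show ?thesis using s bdd by (intro cInf_lower) (auto simp: H_def)
  qed
  ultimately have "survives x {0} t \<longleftrightarrow> t < Inf H"
    using t Inf0 unfolding survives_def by (metis atLeastAtMost_iff insertCI leD le_less_trans linorder_not_le singletonD)
  then show "survives x {0} t \<longleftrightarrow> t < Inf {t. t > 0 \<and> x t = 0}" by (simp add: H_def)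
  show "Inf {t. t > 0 \<and> x t = 0} \<ge> 0" using Inf0 by (simp add: H_def)
qed

lemma action_eq_hitting_time_integral:
  fixes x :: "real \<Rightarrow> nat"
  assumes cont: "\<And>t. t \<ge> 0 \<Longrightarrow> continuous (at_right t) x"
    and bnd: "\<And>t. t \<ge> 0 \<Longrightarrow> \<bar>F (x t)\<bar> \<le> B"
    and hit: "{t. t > 0 \<and> x t = 0} \<noteq> {}" and T: "T > 0" "\<not> survives x {0} T"
  shows "action x {0} F T = (LINT t:{0..Inf {t. t > 0 \<and> x t = 0}}|lborel. F (x t))"
proof -
  define \<tau> where "\<tau> = Inf {t. t > 0 \<and> x t = 0}"
  have surv: "survives x {0} t \<longleftrightarrow> t < \<tau>" if "t \<ge> 0" for t
    unfolding \<tau>_def by (rule survives_iff_less_hitting_time(1)[OF cont hit that])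
  have "\<tau> \<ge> 0"
    unfolding \<tau>_def by (rule survives_iff_less_hitting_time(2)[OF cont hit order_refl])
  then have \<tau>: "\<tau> \<ge> 0" "\<tau> \<le> T" using surv[of T] T by auto
  have "set_integrable lborel {0..T} (\<lambda>t. if survives x {0} t then F (x t) else 0)"
    by (rule grid_action_tendsto(3)[where x = x and F = F, OF cont bnd T(1)])
  then have meas: "(\<lambda>t. indicator {0..T} t *\<^sub>R (if survives x {0} t then F (x t) else 0)) \<in> borel_measurable lborel"
    unfolding set_integrable_def by (rule borel_measurable_integrable)
  have eq: "indicator {0..\<tau>} t *\<^sub>R F (x t) =
      indicator {0..T} t *\<^sub>R (if survives x {0} t then F (x t) else 0) + indicator {\<tau>} t * F (x \<tau>)" for t
    using surv[of t] \<tau> by (auto simp: indicator_def)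
  show ?thesis
    unfolding action_def set_lebesgue_integral_def \<tau>_def[symmetric]
  proof (rule integral_cong_AE[OF meas])
    show "(\<lambda>t. indicator {0..\<tau>} t *\<^sub>R F (x t)) \<in> borel_measurable lborel"
      unfolding eq using meas by (intro borel_measurable_add) auto
    show "AE t in lborel. indicator {0..T} t *\<^sub>R (if survives x {0} t then F (x t) else 0) =
        indicator {0..\<tau>} t *\<^sub>R F (x t)"
      using AE_lborel_singleton[of \<tau>] by eventually_elim (unfold eq, simp)
  qed
qed

lemma action_add_const:
  fixes x :: "real \<Rightarrow> nat"
  assumes cont: "\<And>t. t \<ge> 0 \<Longrightarrow> continuous (at_right t) x"
    and bnd: "\<And>t. t \<ge> 0 \<Longrightarrow> \<bar>F (x t)\<bar> \<le> B" and T: "T > 0" and surv: "survives x Z T"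
  shows "action x Z (\<lambda>j. F j + e) T = action x Z F T + e * T"
proof -
  have eq: "action x Z G T = (LINT t:{0..T}|lborel. G (x t))" for G
    unfolding action_def using survives_mono[OF surv]
    by (intro set_lebesgue_integral_cong) auto
  have "set_integrable lborel {0..T} (\<lambda>t. F (x t))"
    using grid_action_tendsto(3)[where Z = "{}" and x = x and F = F, OF cont bnd T] by simp
  moreover have "set_integrable lborel {0..T} (\<lambda>t. e)"
    unfolding set_integrable_def using T by (intro integrable_scaleR_left integrable_real_indicator) simp_all
  ultimately have "(LINT t:{0..T}|lborel. F (x t) + e) = (LINT t:{0..T}|lborel. F (x t)) + (LINT t:{0..T}|lborel. e)"
    by (rule set_integral_add(2))
  then show ?thesis using T by (simp add: eq set_lebesgue_integral_def)
qed

section \<open>The Feynman--Kac formula\<close>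

definition depends_upto :: "nat \<Rightarrow> ((nat \<Rightarrow> nat) \<Rightarrow> real) \<Rightarrow> bool" where
  "depends_upto k \<Phi> \<longleftrightarrow> (\<forall>y z. (\<forall>j\<le>k. y j = z j) \<longrightarrow> \<Phi> y = \<Phi> z)"

locale jump_chain =
  fixes N :: nat and q :: "nat \<Rightarrow> nat \<Rightarrow> real"
    and P :: "nat \<Rightarrow> 'w measure" and X :: "real \<Rightarrow> 'w \<Rightarrow> nat"
  assumes markov: "markov_chain {0..N} q P X"
begin

abbreviation S :: "nat set" where "S \<equiv> {0..N}"

definition trans_prob :: "real \<Rightarrow> nat \<Rightarrow> nat \<Rightarrow> real" where
  "trans_prob d i j = \<P>(\<omega> in P i. X d \<omega> = j)"

lemmas markov_clauses = bspec[OF markov[unfolded markov_chain_def]]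
lemmas markov_rest = markov_clauses[THEN conjunct2]
lemmas prob_space_P = markov_clauses[THEN conjunct1]
lemmas measurable_X = markov_rest[THEN conjunct1, rule_format]
lemmas X_paths = markov_rest[THEN conjunct2, THEN conjunct1, rule_format]
lemmas X_in_S = X_paths[THEN conjunct1]
lemmas X_right_continuous = X_paths[THEN conjunct2]
lemmas X_start = markov_rest[THEN conjunct2, THEN conjunct2, THEN conjunct1]
lemmas markov_property =
  markov_rest[THEN conjunct2, THEN conjunct2, THEN conjunct2, THEN conjunct1, folded trans_prob_def]
lemmas trans_prob_rate =
  markov_rest[THEN conjunct2, THEN conjunct2, THEN conjunct2, THEN conjunct2, rule_format, folded trans_prob_def]

lemma sets_X_path:
  assumes "i \<in> S" "d \<ge> 0"
  shows "{\<omega> \<in> space (P i). \<forall>l\<le>k. X (real l * d) \<omega> = x l} \<in> sets (P i)"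
proof -
  have "{\<omega> \<in> space (P i). \<forall>l\<in>{..k}. X (real l * d) \<omega> = x l} \<in> sets (P i)"
  proof (rule sets.sets_Collect_finite_All)
    fix l
    have "X (real l * d) -` {x l} \<inter> space (P i) \<in> sets (P i)"
      by (rule measurable_sets[OF measurable_X]) (use assms in auto)
    then show "{\<omega> \<in> space (P i). X (real l * d) \<omega> = x l} \<in> sets (P i)"
      by (simp add: vimage_def Int_def conj_commute)
  qed auto
  then show ?thesis by (simp only: Ball_def atMost_iff)
qed

lemma grid_functional_expand:
  assumes i: "i \<in> S" and d: "d \<ge> 0" and \<omega>: "\<omega> \<in> space (P i)"
    and dep: "depends_upto k \<Phi>"
  shows "\<Phi> (\<lambda>l. X (real l * d) \<omega>) = (\<Sum>x\<in>PiE {..k} (\<lambda>_. S).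
    \<Phi> x * indicator {\<omega> \<in> space (P i). \<forall>l\<le>k. X (real l * d) \<omega> = x l} \<omega>)"
proof -
  define y where "y = restrict (\<lambda>l. X (real l * d) \<omega>) {..k}"
  have y: "y \<in> PiE {..k} (\<lambda>_. S)"
    using X_in_S[OF i \<omega>] d by (auto simp: y_def)
  have "(\<forall>l\<le>k. X (real l * d) \<omega> = x l) \<longleftrightarrow> x = y" if "x \<in> PiE {..k} (\<lambda>_. S)" for x
  proof
    assume *: "\<forall>l\<le>k. X (real l * d) \<omega> = x l"
    show "x = y"
      by (rule PiE_ext[OF that y]) (use * in \<open>auto simp: y_def\<close>)
  qed (auto simp: y_def)
  then have "(\<Sum>x\<in>PiE {..k} (\<lambda>_. S).
      \<Phi> x * indicator {\<omega> \<in> space (P i). \<forall>l\<le>k. X (real l * d) \<omega> = x l} \<omega>) =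
      (\<Sum>x\<in>PiE {..k} (\<lambda>_. S). if x = y then \<Phi> x else 0)"
    using \<omega> by (intro sum.cong) (auto simp: indicator_def)
  also have "\<dots> = \<Phi> y"
    using y by (simp add: finite_PiE)
  also have "\<dots> = \<Phi> (\<lambda>l. X (real l * d) \<omega>)"
    using dep by (auto simp: y_def depends_upto_def)
  finally show ?thesis by simp
qed

lemma
  assumes i: "i \<in> S" and d: "d \<ge> 0"
    and dep: "depends_upto k \<Phi>"
  shows grid_functional_integrable: "integrable (P i) (\<lambda>\<omega>. \<Phi> (\<lambda>l. X (real l * d) \<omega>))"
    and grid_functional_integral: "(LINT \<omega>|P i. \<Phi> (\<lambda>l. X (real l * d) \<omega>)) =
      (\<Sum>x\<in>PiE {..k} (\<lambda>_. S). \<Phi> x * \<P>(\<omega> in P i. \<forall>l\<le>k. X (real l * d) \<omega> = x l))"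
proof -
  interpret prob_space "P i" by (rule prob_space_P[OF i])
  define E where "E x = {\<omega> \<in> space (P i). \<forall>l\<le>k. X (real l * d) \<omega> = x l}" for x
  have E: "E x \<in> sets (P i)" for x
    unfolding E_def by (rule sets_X_path[OF i d])
  have int: "integrable (P i) (\<lambda>\<omega>. \<Phi> x * indicator (E x) \<omega>)" for x
    using E by (intro integrable_mult_right integrable_real_indicator) (simp_all add: emeasure_eq_measure)
  note ex = grid_functional_expand[OF i d _ dep, folded E_def]
  show "integrable (P i) (\<lambda>\<omega>. \<Phi> (\<lambda>l. X (real l * d) \<omega>))"
    by (rule Bochner_Integration.integrable_cong[OF refl ex, THEN iffD2])
       (assumption, rule Bochner_Integration.integrable_sum[OF int])
  have "(LINT \<omega>|P i. \<Phi> (\<lambda>l. X (real l * d) \<omega>)) =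
    (LINT \<omega>|P i. (\<Sum>x\<in>PiE {..k} (\<lambda>_. S). \<Phi> x * indicator (E x) \<omega>))"
    by (rule Bochner_Integration.integral_cong[OF refl ex])
  also have "\<dots> = (\<Sum>x\<in>PiE {..k} (\<lambda>_. S). LINT \<omega>|P i. \<Phi> x * indicator (E x) \<omega>)"
    by (rule Bochner_Integration.integral_sum[OF int])
  also have "\<dots> = (\<Sum>x\<in>PiE {..k} (\<lambda>_. S). \<Phi> x * prob (E x))"
    using E by (intro sum.cong refl) simp
  finally show "(LINT \<omega>|P i. \<Phi> (\<lambda>l. X (real l * d) \<omega>)) =
      (\<Sum>x\<in>PiE {..k} (\<lambda>_. S). \<Phi> x * \<P>(\<omega> in P i. \<forall>l\<le>k. X (real l * d) \<omega> = x l))"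
    unfolding E_def .
qed

lemma grid_markov:
  assumes i: "i \<in> S" and d: "d > 0"
    and dep: "depends_upto k \<Phi>"
  shows "(LINT \<omega>|P i. \<Phi> (\<lambda>l. X (real l * d) \<omega>) * \<psi> (X (real (Suc k) * d) \<omega>)) =
    (LINT \<omega>|P i. \<Phi> (\<lambda>l. X (real l * d) \<omega>) *
      (\<Sum>j\<in>S. trans_prob d (X (real k * d) \<omega>) j * \<psi> j))"
proof -
  interpret prob_space "P i" by (rule prob_space_P[OF i])
  have d': "d \<ge> 0" using d by simp
  define E where "E x = {\<omega> \<in> space (P i). \<forall>l\<le>k. X (real l * d) \<omega> = x l}" for x
  note ex = grid_functional_expand[OF i d' _ dep, folded E_def]
  have *: "(LINT \<omega>|P i. \<Phi> (\<lambda>l. X (real l * d) \<omega>) * indicator {j} (X (real (Suc k) * d) \<omega>)) =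
      (LINT \<omega>|P i. \<Phi> (\<lambda>l. X (real l * d) \<omega>) * trans_prob d (X (real k * d) \<omega>) j)"
    if j: "j \<in> S" for j
  proof -
    define E' where "E' x = {\<omega> \<in> space (P i). \<forall>l\<le>Suc k. X (real l * d) \<omega> = (x(Suc k := j)) l}" for x
    have E': "E' x \<in> sets (P i)" for x
      unfolding E'_def using sets_X_path[OF i d', of "Suc k" "x(Suc k := j)"] .
    have eq: "indicator (E x) \<omega> * indicator {j} (X (real (Suc k) * d) \<omega>) = (indicator (E' x) \<omega> :: real)" for x \<omega>
      by (auto simp: E_def E'_def indicator_def le_Suc_eq)
    have int: "integrable (P i) (\<lambda>\<omega>. \<Phi> x * indicator (E' x) \<omega>)" for x
      using E' by (intro integrable_mult_right integrable_real_indicator) (simp_all add: emeasure_eq_measure)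
    have "(LINT \<omega>|P i. \<Phi> (\<lambda>l. X (real l * d) \<omega>) * indicator {j} (X (real (Suc k) * d) \<omega>)) =
      (LINT \<omega>|P i. (\<Sum>x\<in>PiE {..k} (\<lambda>_. S). \<Phi> x * indicator (E' x) \<omega>))"
    proof (rule Bochner_Integration.integral_cong[OF refl])
      fix \<omega> assume "\<omega> \<in> space (P i)"
      from ex[OF this] show "\<Phi> (\<lambda>l. X (real l * d) \<omega>) * indicator {j} (X (real (Suc k) * d) \<omega>) =
          (\<Sum>x\<in>PiE {..k} (\<lambda>_. S). \<Phi> x * indicator (E' x) \<omega>)"
        by (simp only: sum_distrib_right mult.assoc eq)
    qed
    also have "\<dots> = (\<Sum>x\<in>PiE {..k} (\<lambda>_. S). \<Phi> x * prob (E' x))"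
      using E' by (simp add: Bochner_Integration.integral_sum[OF int])
    also have "\<dots> = (\<Sum>x\<in>PiE {..k} (\<lambda>_. S). (\<Phi> x * trans_prob d (x k) j) * prob (E x))"
    proof (intro sum.cong refl)
      fix x assume x: "x \<in> PiE {..k} (\<lambda>_. S)"
      have "prob (E' x) = \<P>(\<omega> in P i. \<forall>l\<le>k. X (real l * d) \<omega> = (x(Suc k := j)) l) *
          trans_prob (real (Suc k) * d - real k * d) ((x(Suc k := j)) k) ((x(Suc k := j)) (Suc k))"
        using markov_property[OF i, rule_format, of "\<lambda>l. real l * d" k "x(Suc k := j)"] d x j
        by (auto simp: E'_def PiE_iff)
      also have "\<dots> = prob (E x) * trans_prob d (x k) j"
      proof -
        have "{\<omega> \<in> space (P i). \<forall>l\<le>k. X (real l * d) \<omega> = (x(Suc k := j)) l} = E x"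
          by (auto simp: E_def)
        then show ?thesis by (simp add: algebra_simps)
      qed
      finally show "\<Phi> x * prob (E' x) = \<Phi> x * trans_prob d (x k) j * prob (E x)" by simp
    qed
    also have "\<dots> = (LINT \<omega>|P i. \<Phi> (\<lambda>l. X (real l * d) \<omega>) * trans_prob d (X (real k * d) \<omega>) j)"
      unfolding E_def
      by (rule grid_functional_integral[OF i d', of k "\<lambda>y. \<Phi> y * trans_prob d (y k) j", symmetric])
         (use dep in \<open>auto simp: depends_upto_def\<close>)
    finally show ?thesis .
  qed
  have int1: "integrable (P i) (\<lambda>\<omega>. \<Phi> (\<lambda>l. X (real l * d) \<omega>) * indicator {j} (X (real (Suc k) * d) \<omega>))" for j
    by (rule grid_functional_integrable[OF i d', of "Suc k" "\<lambda>y. \<Phi> y * indicator {j} (y (Suc k))"])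
       (use dep in \<open>auto simp: depends_upto_def\<close>)
  have int2: "integrable (P i) (\<lambda>\<omega>. \<Phi> (\<lambda>l. X (real l * d) \<omega>) * trans_prob d (X (real k * d) \<omega>) j)" for j
    by (rule grid_functional_integrable[OF i d', of k "\<lambda>y. \<Phi> y * trans_prob d (y k) j"])
       (use dep in \<open>auto simp: depends_upto_def\<close>)
  have "(LINT \<omega>|P i. \<Phi> (\<lambda>l. X (real l * d) \<omega>) * \<psi> (X (real (Suc k) * d) \<omega>)) =
    (LINT \<omega>|P i. (\<Sum>j\<in>S. \<psi> j * (\<Phi> (\<lambda>l. X (real l * d) \<omega>) * indicator {j} (X (real (Suc k) * d) \<omega>))))"
  proof (rule Bochner_Integration.integral_cong[OF refl])
    fix \<omega> assume "\<omega> \<in> space (P i)"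
    then have XS: "X (real (Suc k) * d) \<omega> \<in> S" using d by (intro X_in_S[OF i]) auto
    define s where "s = X (real (Suc k) * d) \<omega>"
    have "(\<Sum>j\<in>S. \<psi> j * (\<Phi> (\<lambda>l. X (real l * d) \<omega>) * indicator {j} s)) =
      (\<Sum>j\<in>S. if j = s then \<psi> j * \<Phi> (\<lambda>l. X (real l * d) \<omega>) else 0)"
      by (intro sum.cong) auto
    also have "\<dots> = \<Phi> (\<lambda>l. X (real l * d) \<omega>) * \<psi> s"
      using XS by (simp add: s_def)
    finally show "\<Phi> (\<lambda>l. X (real l * d) \<omega>) * \<psi> (X (real (Suc k) * d) \<omega>) =
      (\<Sum>j\<in>S. \<psi> j * (\<Phi> (\<lambda>l. X (real l * d) \<omega>) * indicator {j} (X (real (Suc k) * d) \<omega>)))"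
      by (simp add: s_def)
  qed
  also have "\<dots> = (\<Sum>j\<in>S. \<psi> j * (LINT \<omega>|P i. \<Phi> (\<lambda>l. X (real l * d) \<omega>) * indicator {j} (X (real (Suc k) * d) \<omega>)))"
    by (simp add: Bochner_Integration.integral_sum[OF integrable_mult_right[OF int1]] del: of_nat_Suc)
  also have "\<dots> = (\<Sum>j\<in>S. \<psi> j * (LINT \<omega>|P i. \<Phi> (\<lambda>l. X (real l * d) \<omega>) * trans_prob d (X (real k * d) \<omega>) j))"
    by (intro sum.cong refl) (simp add: * del: of_nat_Suc)
  also have "\<dots> = (LINT \<omega>|P i. (\<Sum>j\<in>S. \<psi> j * (\<Phi> (\<lambda>l. X (real l * d) \<omega>) * trans_prob d (X (real k * d) \<omega>) j)))"
    by (simp add: Bochner_Integration.integral_sum[OF integrable_mult_right[OF int2]])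
  also have "\<dots> = (LINT \<omega>|P i. \<Phi> (\<lambda>l. X (real l * d) \<omega>) *
      (\<Sum>j\<in>S. trans_prob d (X (real k * d) \<omega>) j * \<psi> j))"
    by (simp add: sum_distrib_left mult_ac)
  finally show ?thesis .
qed

lemma generator_limit:
  assumes i: "i \<in> S - Z" and Z: "Z \<subseteq> {0}"
  shows "((\<lambda>d. ((\<Sum>j\<in>S. trans_prob d i j * (if j \<in> Z then h 0 else exp (d * F j) * h j)) - h i) / d)
    \<longlongrightarrow> (\<Sum>j\<in>S. q i j * h j) + F i * h i) (at_right 0)"
proof -
  define \<psi> where "\<psi> d j = (if j \<in> Z then h 0 else exp (d * F j) * h j)" for d :: real and j
  define r where "r d j = (trans_prob d i j - (if i = j then 1 else 0)) / d" for d j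
  have \<psi>: "((\<lambda>d. \<psi> d j) \<longlongrightarrow> h j) (at_right 0)" for j
  proof (cases "j \<in> Z")
    case True
    then have "j = 0" using Z by auto
    then show ?thesis using True by (simp add: \<psi>_def)
  next
    case False
    have "((\<lambda>d. exp (d * F j) * h j) \<longlongrightarrow> exp (0 * F j) * h j) (at_right 0)"
      by (intro tendsto_intros)
    then show ?thesis using False by (simp add: \<psi>_def)
  qed
  have "((\<lambda>x::real. exp (x * F i)) has_field_derivative F i) (at 0)"
    by (auto intro!: derivative_eq_intros)
  then have "((\<lambda>d. (exp (d * F i) - 1) / d) \<longlongrightarrow> F i) (at 0)"
    by (simp add: has_field_derivative_iff)
  then have e: "((\<lambda>d. (exp (d * F i) - 1) / d) \<longlongrightarrow> F i) (at_right 0)"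
    by (rule tendsto_mono[rotated]) (simp add: at_le)
  have "((\<lambda>d. (\<Sum>j\<in>S. r d j * \<psi> d j) + (exp (d * F i) - 1) / d * h i)
      \<longlongrightarrow> (\<Sum>j\<in>S. q i j * h j) + F i * h i) (at_right 0)"
    unfolding r_def using i by (intro tendsto_add tendsto_sum tendsto_mult \<psi> e tendsto_const trans_prob_rate) auto
  moreover have "\<forall>\<^sub>F d in at_right 0. (\<Sum>j\<in>S. r d j * \<psi> d j) + (exp (d * F i) - 1) / d * h i =
      ((\<Sum>j\<in>S. trans_prob d i j * \<psi> d j) - h i) / d"
    unfolding eventually_at_right_field
  proof (intro exI[of _ 1] conjI allI impI)
    fix d :: real assume d: "d > 0"
    have "(\<Sum>j\<in>S. r d j * \<psi> d j) =
        (\<Sum>j\<in>S. trans_prob d i j * \<psi> d j / d - (if i = j then \<psi> d j / d else 0))"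
      using d by (intro sum.cong) (auto simp: r_def field_simps)
    also have "\<dots> = (\<Sum>j\<in>S. trans_prob d i j * \<psi> d j) / d - \<psi> d i / d"
      using i by (simp add: sum_subtractf sum_divide_distrib)
    finally show "(\<Sum>j\<in>S. r d j * \<psi> d j) + (exp (d * F i) - 1) / d * h i =
      ((\<Sum>j\<in>S. trans_prob d i j * \<psi> d j) - h i) / d"
      using i d by (simp add: \<psi>_def field_simps)
  qed auto
  ultimately show ?thesis unfolding \<psi>_def by (rule Lim_transform_eventually)
qed

lemma grid_payoff_expectation_le:
  assumes i: "i \<in> S" and d: "d > 0" and Z: "Z \<subseteq> {0}" and B: "\<And>j. j \<in> S \<Longrightarrow> \<bar>F j\<bar> \<le> B"
    and \<eta>: "\<eta> \<ge> 0"
    and step: "\<And>j. j \<in> S - Z \<Longrightarrow>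
      (\<Sum>l\<in>S. trans_prob d j l * (if l \<in> Z then h 0 else exp (d * F l) * h l)) \<le> h j + \<eta>"
  shows "(LINT \<omega>|P i. grid_payoff d (\<lambda>l. X (real l * d) \<omega>) Z F h k) \<le> h i + real k * \<eta> * exp (real k * d * B)"
proof (induction k)
  case 0
  have "AE \<omega> in P i. grid_payoff d (\<lambda>l. X (real l * d) \<omega>) Z F h 0 = h i"
    using X_start[OF i] by eventually_elim (use Z in \<open>auto simp: grid_payoff_def grid_action_def grid_survives_def\<close>)
  moreover have "integrable (P i) (\<lambda>\<omega>. grid_payoff d (\<lambda>l. X (real l * d) \<omega>) Z F h 0)"
    using d by (intro grid_functional_integrable[OF i])
      (auto simp: depends_upto_def grid_payoff_def grid_action_def grid_survives_def)
  ultimately have "(LINT \<omega>|P i. grid_payoff d (\<lambda>l. X (real l * d) \<omega>) Z F h 0) = (LINT \<omega>|P i. h i)"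
    by (intro integral_cong_AE) auto
  then show ?case using prob_space_P[OF i] by (simp add: prob_space.prob_space)
next
  case (Suc k)
  interpret prob_space "P i" by (rule prob_space_P[OF i])
  have "B \<ge> 0" using B[OF i] by linarith
  define Y where "Y \<omega> l = X (real l * d) \<omega>" for \<omega> l
  define \<psi> where "\<psi> j = (if j \<in> Z then h 0 else exp (d * F j) * h j)" for j
  define \<Phi> where "\<Phi> y = (if grid_survives y Z k then exp (grid_action d y Z F k) else 0)" for y
  define \<Xi> where "\<Xi> y = (if grid_survives y Z k then 0 else grid_payoff d y Z F h k)" for y
  define R where "R j = (\<Sum>l\<in>S. trans_prob d j l * \<psi> l)" for j
  have dep_act: "grid_survives y Z k = grid_survives z Z k \<and> grid_action d y Z F k = grid_action d z Z F k \<and> y k = z k"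
    if "\<forall>j\<le>k. y j = z j" for y z :: "nat \<Rightarrow> nat"
    using that grid_survives_cong[of k y z] grid_action_cong[of k y z] by simp
  have dep\<Phi>: "depends_upto k \<Phi>" and dep\<Xi>: "depends_upto k \<Xi>"
    and deppay: "depends_upto k (\<lambda>y. grid_payoff d y Z F h k)"
    and depR: "depends_upto k (\<lambda>y. \<Phi> y * R (y k))"
    unfolding depends_upto_def \<Phi>_def \<Xi>_def grid_payoff_def using dep_act by (auto; metis)+
  have dep\<Phi>': "depends_upto (Suc k) (\<lambda>y. \<Phi> y * \<psi> (y (Suc k)))"
    using dep\<Phi> by (auto simp: depends_upto_def)
  note int = grid_functional_integrable[OF i less_imp_le[OF d], folded Y_def]
  have pay: "grid_payoff d (Y \<omega>) Z F h (Suc k) = \<Phi> (Y \<omega>) * \<psi> (Y \<omega> (Suc k)) + \<Xi> (Y \<omega>)" for \<omega>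
    by (auto simp: grid_payoff_Suc \<Phi>_def \<Xi>_def \<psi>_def)
  have "(LINT \<omega>|P i. grid_payoff d (Y \<omega>) Z F h (Suc k)) =
      (LINT \<omega>|P i. \<Phi> (Y \<omega>) * \<psi> (Y \<omega> (Suc k))) + (LINT \<omega>|P i. \<Xi> (Y \<omega>))"
    unfolding pay by (intro Bochner_Integration.integral_add int[OF dep\<Phi>'] int[OF dep\<Xi>])
  also have "(LINT \<omega>|P i. \<Phi> (Y \<omega>) * \<psi> (Y \<omega> (Suc k))) = (LINT \<omega>|P i. \<Phi> (Y \<omega>) * R (Y \<omega> k))"
    using grid_markov[OF i d dep\<Phi>, of \<psi>] unfolding Y_def R_def .
  also have "\<dots> + (LINT \<omega>|P i. \<Xi> (Y \<omega>)) = (LINT \<omega>|P i. \<Phi> (Y \<omega>) * R (Y \<omega> k) + \<Xi> (Y \<omega>))"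
    by (rule Bochner_Integration.integral_add[symmetric, OF int[OF depR] int[OF dep\<Xi>]])
  also have "\<dots> \<le> (LINT \<omega>|P i. grid_payoff d (Y \<omega>) Z F h k + \<eta> * exp (real k * d * B))"
  proof (rule integral_mono)
    fix \<omega> assume \<omega>: "\<omega> \<in> space (P i)"
    have YS: "Y \<omega> l \<in> S" for l
      unfolding Y_def using d by (intro X_in_S[OF i \<omega>]) auto
    show "\<Phi> (Y \<omega>) * R (Y \<omega> k) + \<Xi> (Y \<omega>) \<le> grid_payoff d (Y \<omega>) Z F h k + \<eta> * exp (real k * d * B)"
    proof (cases "grid_survives (Y \<omega>) Z k")
      case True
      then have "Y \<omega> k \<in> S - Z" using YS by (auto simp: grid_survives_def)
      then have "R (Y \<omega> k) \<le> h (Y \<omega> k) + \<eta>"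
        unfolding R_def \<psi>_def by (rule step)
      then have "exp (grid_action d (Y \<omega>) Z F k) * R (Y \<omega> k) \<le>
          exp (grid_action d (Y \<omega>) Z F k) * (h (Y \<omega> k) + \<eta>)"
        by simp
      moreover have "exp (grid_action d (Y \<omega>) Z F k) * \<eta> \<le> exp (real k * d * B) * \<eta>"
        using abs_grid_action_le[of d F "Y \<omega>" B Z k] B[OF YS] d \<eta>
        by (intro mult_right_mono) auto
      ultimately show ?thesis using True by (simp add: \<Phi>_def \<Xi>_def grid_payoff_def algebra_simps)
    qed (use \<eta> in \<open>simp add: \<Phi>_def \<Xi>_def\<close>)
  qed (intro Bochner_Integration.integrable_add int[OF depR] int[OF dep\<Xi>] int[OF deppay] integrable_const)+
  also have "\<dots> = (LINT \<omega>|P i. grid_payoff d (Y \<omega>) Z F h k) + \<eta> * exp (real k * d * B)"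
    by (subst Bochner_Integration.integral_add[OF int[OF deppay] integrable_const]) (simp add: prob_space)
  also have "\<dots> \<le> h i + real (Suc k) * \<eta> * exp (real k * d * B)"
    using Suc.IH by (simp add: Y_def[abs_def] algebra_simps)
  also have "\<dots> \<le> h i + real (Suc k) * \<eta> * exp (real (Suc k) * d * B)"
    using \<eta> d \<open>B \<ge> 0\<close> by (intro add_left_mono mult_left_mono) (auto intro!: mult_right_mono)
  finally show ?case by (simp add: Y_def)
qed

lemma
  assumes i: "i \<in> S" and T: "T > 0"
  shows measurable_action: "(\<lambda>\<omega>. action (\<lambda>t. X t \<omega>) Z F T) \<in> borel_measurable (P i)"
    and measurable_survives: "(\<lambda>\<omega>. of_bool (survives (\<lambda>t. X t \<omega>) Z T) :: real) \<in> borel_measurable (P i)"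
    and payoff_integrable: "integrable (P i) (\<lambda>\<omega>. payoff (\<lambda>t. X t \<omega>) Z F h T)"
    and grid_payoff_tendsto:
      "(\<lambda>n. LINT \<omega>|P i. grid_payoff (T / real (Suc n)) (\<lambda>l. X (real l * (T / real (Suc n))) \<omega>) Z F h (Suc n))
        \<longlonglongrightarrow> (LINT \<omega>|P i. payoff (\<lambda>t. X t \<omega>) Z F h T)"
proof -
  interpret prob_space "P i" by (rule prob_space_P[OF i])
  define d where "d n = T / real (Suc n)" for n
  have d: "d n > 0" and dT: "real (Suc n) * d n = T" for n using T by (auto simp: d_def)
  define B where "B = (\<Sum>j\<in>S. \<bar>F j\<bar>)"
  define H where "H = (\<Sum>j\<in>insert 0 S. \<bar>h j\<bar>)"
  have B: "\<bar>F j\<bar> \<le> B" if "j \<in> S" for j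
    unfolding B_def using that by (intro member_le_sum) auto
  have H: "\<bar>h j\<bar> \<le> H" if "j \<in> insert 0 S" for j
    unfolding H_def using that by (intro member_le_sum) auto
  define Y where "Y n \<omega> l = X (real l * d n) \<omega>" for n \<omega> l
  have YS: "Y n \<omega> l \<in> S" if "\<omega> \<in> space (P i)" for n \<omega> l
    unfolding Y_def using d[of n] by (intro X_in_S[OF i that]) auto
  note cont = X_right_continuous[OF i]
  have bnd: "\<bar>F (X t \<omega>)\<bar> \<le> B" if "\<omega> \<in> space (P i)" "t \<ge> 0" for t \<omega>
    by (rule B[OF X_in_S[OF i that]])
  note int = grid_functional_integrable[OF i less_imp_le[OF d], folded Y_def]
  have dep: "grid_survives y Z k = grid_survives z Z k \<and> grid_action d' y Z F k = grid_action d' z Z F k \<and> y k = z k"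
    if "\<forall>j\<le>k. y j = z j" for y z :: "nat \<Rightarrow> nat" and k and d' :: real
    using that grid_survives_cong[of k y z] grid_action_cong[of k y z] by simp
  have lim_act: "(\<lambda>n. grid_action (d n) (Y n \<omega>) Z F (Suc n)) \<longlonglongrightarrow> action (\<lambda>t. X t \<omega>) Z F T"
    if "\<omega> \<in> space (P i)" for \<omega>
    using grid_action_tendsto(1)[where x = "\<lambda>t. X t \<omega>" and F = F and Z = Z, OF cont[OF that] bnd[OF that] T]
    by (simp add: d_def[abs_def] Y_def[abs_def] del: of_nat_Suc)
  have lim_surv: "\<forall>\<^sub>F n in sequentially. grid_survives (Y n \<omega>) Z (Suc n) \<longleftrightarrow> survives (\<lambda>t. X t \<omega>) Z T"
    if "\<omega> \<in> space (P i)" for \<omega>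
    using grid_action_tendsto(2)[where x = "\<lambda>t. X t \<omega>" and F = F and Z = Z, OF cont[OF that] bnd[OF that] T]
    by (simp add: d_def[abs_def] Y_def[abs_def] del: of_nat_Suc)
  show "(\<lambda>\<omega>. action (\<lambda>t. X t \<omega>) Z F T) \<in> borel_measurable (P i)"
  proof (rule borel_measurable_LIMSEQ_real[OF lim_act])
    fix n show "(\<lambda>\<omega>. grid_action (d n) (Y n \<omega>) Z F (Suc n)) \<in> borel_measurable (P i)"
      by (rule borel_measurable_integrable, rule int[of "Suc n" "\<lambda>y. grid_action (d n) y Z F (Suc n)"])
         (use dep in \<open>auto simp: depends_upto_def\<close>)
  qed
  show "(\<lambda>\<omega>. of_bool (survives (\<lambda>t. X t \<omega>) Z T) :: real) \<in> borel_measurable (P i)"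
  proof (rule borel_measurable_LIMSEQ_real)
    fix \<omega> assume "\<omega> \<in> space (P i)"
    from lim_surv[OF this] show "(\<lambda>n. of_bool (grid_survives (Y n \<omega>) Z (Suc n)) :: real)
        \<longlonglongrightarrow> of_bool (survives (\<lambda>t. X t \<omega>) Z T)"
      by (intro tendsto_eventually) (auto elim!: eventually_mono)
  next
    fix n show "(\<lambda>\<omega>. of_bool (grid_survives (Y n \<omega>) Z (Suc n)) :: real) \<in> borel_measurable (P i)"
      by (rule borel_measurable_integrable, rule int[of "Suc n" "\<lambda>y. of_bool (grid_survives y Z (Suc n))"])
         (use dep in \<open>auto simp: depends_upto_def\<close>)
  qed
  define pay where "pay n \<omega> = grid_payoff (d n) (Y n \<omega>) Z F h (Suc n)" for n \<omega>
  have lim_pay: "(\<lambda>n. pay n \<omega>) \<longlonglongrightarrow> payoff (\<lambda>t. X t \<omega>) Z F h T" if "\<omega> \<in> space (P i)" for \<omega>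
    unfolding pay_def grid_payoff_def payoff_def
  proof (intro tendsto_mult tendsto_exp lim_act that tendsto_eventually)
    show "\<forall>\<^sub>F n in sequentially. (if grid_survives (Y n \<omega>) Z (Suc n) then h (Y n \<omega> (Suc n)) else h 0) =
        (if survives (\<lambda>t. X t \<omega>) Z T then h (X T \<omega>) else h 0)"
      using lim_surv[OF that] by eventually_elim (simp add: Y_def dT del: of_nat_Suc)
  qed
  have meas_pay: "(\<lambda>\<omega>. pay n \<omega>) \<in> borel_measurable (P i)" for n
    unfolding pay_def grid_payoff_def
    by (rule borel_measurable_integrable, rule int[of "Suc n" "\<lambda>y. exp (grid_action (d n) y Z F (Suc n)) *
          (if grid_survives y Z (Suc n) then h (y (Suc n)) else h 0)"])
       (use dep in \<open>auto simp: depends_upto_def\<close>)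
  have meas_lim: "(\<lambda>\<omega>. payoff (\<lambda>t. X t \<omega>) Z F h T) \<in> borel_measurable (P i)"
    by (rule borel_measurable_LIMSEQ_real[OF lim_pay meas_pay])
  have bound: "norm (pay n \<omega>) \<le> exp (T * B) * H" if "\<omega> \<in> space (P i)" for n \<omega>
  proof -
    have "\<bar>grid_action (d n) (Y n \<omega>) Z F (Suc n)\<bar> \<le> T * B"
      using abs_grid_action_le[of "d n" F "Y n \<omega>" B Z "Suc n"] B[OF YS[OF that]] d[of n] unfolding dT by simp
    moreover have "\<bar>if grid_survives (Y n \<omega>) Z (Suc n) then h (Y n \<omega> (Suc n)) else h 0\<bar> \<le> H"
      using H YS[OF that, of n "Suc n"] by auto
    ultimately show ?thesis
      unfolding pay_def grid_payoff_def by (auto simp: abs_mult simp del: of_nat_Suc intro!: mult_mono)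
  qed
  have *: "AE \<omega> in P i. (\<lambda>n. pay n \<omega>) \<longlonglongrightarrow> payoff (\<lambda>t. X t \<omega>) Z F h T"
    "\<And>n. AE \<omega> in P i. norm (pay n \<omega>) \<le> exp (T * B) * H"
    using lim_pay bound by auto
  show "integrable (P i) (\<lambda>\<omega>. payoff (\<lambda>t. X t \<omega>) Z F h T)"
    by (rule integrable_dominated_convergence[OF meas_lim meas_pay integrable_const *])
  show "(\<lambda>n. LINT \<omega>|P i. grid_payoff (T / real (Suc n)) (\<lambda>l. X (real l * (T / real (Suc n))) \<omega>) Z F h (Suc n))
        \<longlonglongrightarrow> (LINT \<omega>|P i. payoff (\<lambda>t. X t \<omega>) Z F h T)"
    using integral_dominated_convergence[OF meas_lim meas_pay integrable_const *]
    by (simp add: pay_def Y_def[abs_def] d_def[abs_def] del: of_nat_Suc)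
qed

theorem feynman_kac_le:
  assumes i: "i \<in> S" and T: "T > 0" and Z: "Z \<subseteq> {0}"
    and super: "\<And>j. j \<in> S - Z \<Longrightarrow> (\<Sum>l\<in>S. q j l * h l) + F j * h j \<le> 0"
  shows "(LINT \<omega>|P i. payoff (\<lambda>t. X t \<omega>) Z F h T) \<le> h i"
proof (rule field_le_epsilon)
  fix \<epsilon> :: real assume "\<epsilon> > 0"
  define B where "B = (\<Sum>j\<in>S. \<bar>F j\<bar>)"
  have B: "\<bar>F j\<bar> \<le> B" if "j \<in> S" for j
    unfolding B_def using that by (intro member_le_sum) auto
  define \<eta> where "\<eta> = \<epsilon> / (T * exp (T * B))"
  have "\<eta> > 0" using \<open>\<epsilon> > 0\<close> T by (simp add: \<eta>_def)
  define \<psi> where "\<psi> d j = (\<Sum>l\<in>S. trans_prob d j l * (if l \<in> Z then h 0 else exp (d * F l) * h l))" for d j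
  have "\<forall>\<^sub>F d in at_right 0. \<forall>j\<in>S - Z. (\<psi> d j - h j) / d < \<eta>"
  proof (intro eventually_ball_finite ballI)
    fix j assume j: "j \<in> S - Z"
    have "(\<Sum>l\<in>S. q j l * h l) + F j * h j < \<eta>" using super[OF j] \<open>\<eta> > 0\<close> by simp
    with generator_limit[OF j Z, of h F] show "\<forall>\<^sub>F d in at_right 0. (\<psi> d j - h j) / d < \<eta>"
      unfolding \<psi>_def by (rule order_tendstoD)
  qed auto
  moreover have "filterlim (\<lambda>n. T / real (Suc n)) (at_right 0) sequentially"
    unfolding filterlim_at
    using T LIMSEQ_Suc[OF lim_const_over_n[of T]] by auto
  ultimately have "\<forall>\<^sub>F n in sequentially. \<forall>j\<in>S - Z. (\<psi> (T / real (Suc n)) j - h j) / (T / real (Suc n)) < \<eta>"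
    by (rule eventually_compose_filterlim)
  then have "\<forall>\<^sub>F n in sequentially.
     (LINT \<omega>|P i. grid_payoff (T / real (Suc n)) (\<lambda>l. X (real l * (T / real (Suc n))) \<omega>) Z F h (Suc n)) \<le> h i + \<epsilon>"
  proof eventually_elim
    case (elim n)
    define d where "d = T / real (Suc n)"
    have d: "d > 0" "real (Suc n) * d = T" using T by (auto simp: d_def)
    have "(LINT \<omega>|P i. grid_payoff d (\<lambda>l. X (real l * d) \<omega>) Z F h (Suc n)) \<le>
        h i + real (Suc n) * (\<eta> * d) * exp (real (Suc n) * d * B)"
    proof (rule grid_payoff_expectation_le[OF i d(1) Z B])
      fix j assume "j \<in> S - Z"
      with elim have "(\<psi> d j - h j) / d < \<eta>" by (simp add: d_def)
      then show "(\<Sum>l\<in>S. trans_prob d j l * (if l \<in> Z then h 0 else exp (d * F l) * h l)) \<le> h j + \<eta> * d"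
        using d(1) by (simp add: \<psi>_def field_simps)
    qed (use d \<open>\<eta> > 0\<close> in auto)
    also have "real (Suc n) * (\<eta> * d) * exp (real (Suc n) * d * B) = \<eta> * T * exp (T * B)"
      using d(2) by (simp add: algebra_simps del: of_nat_Suc)
    also have "\<dots> = \<epsilon>" using T by (simp add: \<eta>_def)
    finally show ?case by (simp add: d_def)
  qed
  then show "(LINT \<omega>|P i. payoff (\<lambda>t. X t \<omega>) Z F h T) \<le> h i + \<epsilon>"
    by (rule tendsto_upperbound[OF grid_payoff_tendsto[OF i T]]) simp
qed

corollary feynman_kac_eq:
  assumes i: "i \<in> S" and T: "T > 0" and Z: "Z \<subseteq> {0}"
    and eq: "\<And>j. j \<in> S - Z \<Longrightarrow> (\<Sum>l\<in>S. q j l * h l) + F j * h j = 0"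
  shows "(LINT \<omega>|P i. payoff (\<lambda>t. X t \<omega>) Z F h T) = h i"
proof (rule antisym)
  show "(LINT \<omega>|P i. payoff (\<lambda>t. X t \<omega>) Z F h T) \<le> h i"
    by (rule feynman_kac_le[OF i T Z]) (simp add: eq)
  have "(LINT \<omega>|P i. payoff (\<lambda>t. X t \<omega>) Z F (\<lambda>j. - h j) T) \<le> - h i"
  proof (rule feynman_kac_le[OF i T Z])
    fix j assume "j \<in> S - Z"
    from eq[OF this] show "(\<Sum>l\<in>S. q j l * - h l) + F j * - h j \<le> 0" by (simp add: sum_negf)
  qed
  moreover have "payoff x Z F (\<lambda>j. - h j) T = - payoff x Z F h T" for x
    by (simp add: payoff_def)
  ultimately show "h i \<le> (LINT \<omega>|P i. payoff (\<lambda>t. X t \<omega>) Z F h T)" by simp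
qed

end

section \<open>Growth rate and hitting expectation\<close>

lemma log_growth_rate:
  fixes E :: "real \<Rightarrow> real"
  assumes "\<theta> > 0" "A > 0" and E: "\<And>T. T > 0 \<Longrightarrow> exp (\<mu> * T) * A \<le> E T \<and> E T \<le> exp (\<mu> * T) * B"
  shows "((\<lambda>T. 1 / (\<theta> * T) * ln (E T)) \<longlongrightarrow> \<mu> / \<theta>) at_top"
proof -
  have "exp (\<mu> * 1) * A \<le> exp (\<mu> * 1) * B" using E[of 1] by linarith
  then have "B > 0" using \<open>A > 0\<close> by simp
  have lim: "((\<lambda>T. \<mu> / \<theta> + ln C / \<theta> / T) \<longlongrightarrow> \<mu> / \<theta>) at_top" for C :: real
    using tendsto_add[OF tendsto_const[of "\<mu> / \<theta>"]
        tendsto_divide_0[OF tendsto_const[of "ln C / \<theta>"] filterlim_at_top_imp_at_infinity[OF filterlim_ident]]]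
    by simp
  have eq: "1 / (\<theta> * T) * ln (exp (\<mu> * T) * C) = \<mu> / \<theta> + ln C / \<theta> / T" if "T > 0" "C > 0" for T C
    using that \<open>\<theta> > 0\<close> by (simp add: ln_mult field_simps)
  have low: "\<mu> / \<theta> + ln A / \<theta> / T \<le> 1 / (\<theta> * T) * ln (E T)" if "T > 0" for T
    unfolding eq[OF that \<open>A > 0\<close>, symmetric]
  proof (rule mult_left_mono)
    show "ln (exp (\<mu> * T) * A) \<le> ln (E T)" using E[OF that] \<open>A > 0\<close> by (intro ln_mono) auto
  qed (use that \<open>\<theta> > 0\<close> in simp)
  have up: "1 / (\<theta> * T) * ln (E T) \<le> \<mu> / \<theta> + ln B / \<theta> / T" if "T > 0" for T
    unfolding eq[OF that \<open>B > 0\<close>, symmetric]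
  proof (rule mult_left_mono)
    have "E T > 0" using E[OF that] mult_pos_pos[OF exp_gt_zero \<open>A > 0\<close>, of "\<mu> * T"] by linarith
    then show "ln (E T) \<le> ln (exp (\<mu> * T) * B)" using E[OF that] by (intro ln_mono) auto
  qed (use that \<open>\<theta> > 0\<close> in simp)
  show ?thesis
  proof (rule tendsto_sandwich[OF _ _ lim[of A] lim[of B]])
    show "\<forall>\<^sub>F T in at_top. \<mu> / \<theta> + ln A / \<theta> / T \<le> 1 / (\<theta> * T) * ln (E T)"
      using eventually_gt_at_top[of 0] by eventually_elim (rule low)
    show "\<forall>\<^sub>F T in at_top. 1 / (\<theta> * T) * ln (E T) \<le> \<mu> / \<theta> + ln B / \<theta> / T"
      using eventually_gt_at_top[of 0] by eventually_elim (rule up)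
  qed
qed

definition tilted :: "(nat \<Rightarrow> nat \<Rightarrow> real) \<Rightarrow> (nat \<Rightarrow> real) \<Rightarrow> nat \<Rightarrow> nat \<Rightarrow> real" where
  "tilted q g i j = q i j + (if i = j then g i else 0)"

locale irreducible_jump_chain = jump_chain +
  assumes irred: "irreducible_chain {0..N} P X"
    and rate_nonneg: "i \<in> {0..N} \<Longrightarrow> j \<in> {0..N} \<Longrightarrow> j \<noteq> i \<Longrightarrow> q i j \<ge> 0"
    and rate_diag: "i \<in> {0..N} \<Longrightarrow> q i i = - (\<Sum>j\<in>{0..N} - {i}. q i j)"
begin

lemma rate_sum: "i \<in> S \<Longrightarrow> (\<Sum>j\<in>S. q i j) = 0"
  using rate_diag[of i] by (subst sum.remove[of _ i]) auto

text \<open>If no rate led from \<open>S - D\<close> to \<open>D\<close>, the indicator of \<open>D\<close> would be a supersolution, so by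
  Feynman--Kac \<open>D\<close> would never be reached from outside.\<close>

lemma rates_irreducible:
  assumes D: "D \<subseteq> S" "D \<noteq> {}" "D \<noteq> S"
  shows "\<exists>j\<in>S - D. \<exists>i\<in>D. q j i > 0"
proof (rule ccontr)
  assume closed: "\<not> ?thesis"
  obtain i j where ij: "i \<in> D" "j \<in> S - D" using D by blast
  then have i: "i \<in> S" and j: "j \<in> S" using D by auto
  interpret prob_space "P j" by (rule prob_space_P[OF j])
  obtain t where t: "t \<ge> 0" "\<P>(\<omega> in P j. X t \<omega> = i) > 0"
    using irred i j unfolding irreducible_chain_def by blast
  have "t \<noteq> 0"
  proof
    assume "t = 0"
    moreover have "\<P>(\<omega> in P j. X 0 \<omega> = i) = 0"
      using X_start[OF j] by (intro prob_eq_0_AE) (use ij in auto)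
    ultimately show False using t by simp
  qed
  then have T: "t > 0" using t by simp
  define h :: "nat \<Rightarrow> real" where "h = indicator D"
  have "(LINT \<omega>|P j. payoff (\<lambda>s. X s \<omega>) {} (\<lambda>_. 0) h t) \<le> h j"
  proof (rule feynman_kac_le[OF j T])
    fix k assume k: "k \<in> S - {}"
    have "(\<Sum>l\<in>S. q k l * h l) \<le> 0"
    proof (cases "k \<in> D")
      case True
      have "(\<Sum>l\<in>S. q k l * h l) \<le> (\<Sum>l\<in>S. q k l)"
      proof (rule sum_mono)
        fix l assume "l \<in> S"
        then show "q k l * h l \<le> q k l"
          using True k rate_nonneg[of k l] by (cases "l = k") (auto simp: h_def indicator_def)
      qed
      then show ?thesis using rate_sum k by simp
    next
      case False
      have "q k l * h l \<le> 0" if "l \<in> S" for l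
      proof (cases "l \<in> D")
        case True
        then have "\<not> q k l > 0" using closed k False by blast
        then show ?thesis using True by (simp add: h_def)
      qed (simp add: h_def)
      then show ?thesis by (rule sum_nonpos)
    qed
    then show "(\<Sum>l\<in>S. q k l * h l) + 0 * h k \<le> 0" by simp
  qed simp
  then have le0: "(LINT \<omega>|P j. payoff (\<lambda>s. X s \<omega>) {} (\<lambda>_. 0) h t) \<le> 0"
    using ij by (simp add: h_def)
  define E where "E = {\<omega> \<in> space (P j). X t \<omega> = i}"
  have E: "E \<in> events"
    using measurable_sets[OF measurable_X[OF j t(1)], of "{i}"]
    by (simp add: E_def vimage_def Int_def conj_commute)
  then have "prob E = (LINT \<omega>|P j. indicator E \<omega>)" by simp
  also have "\<dots> \<le> (LINT \<omega>|P j. payoff (\<lambda>s. X s \<omega>) {} (\<lambda>_. 0) h t)"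
  proof (rule integral_mono)
    show "integrable (P j) (indicat_real E)"
      using E by (intro integrable_real_indicator) (simp_all add: emeasure_eq_measure)
    show "integrable (P j) (\<lambda>\<omega>. payoff (\<lambda>s. X s \<omega>) {} (\<lambda>_. 0) h t)"
      by (rule payoff_integrable[OF j T])
    show "indicator E \<omega> \<le> payoff (\<lambda>s. X s \<omega>) {} (\<lambda>_. 0) h t" for \<omega>
      using ij by (auto simp: E_def payoff_def action_def h_def indicator_def)
  qed
  finally show False using le0 t by (simp add: E_def)
qed

lemma irreducible_tilted: "irreducible_metzler_matrix S (tilted q g)"
proof unfold_locales
  show "0 \<le> tilted q g i j" if "i \<in> S" "j \<in> S" "j \<noteq> i" for i j
    using that rate_nonneg[of i j] by (auto simp: tilted_def)
  show "\<exists>j\<in>S - D. \<exists>i\<in>D. 0 < tilted q g j i" if D: "D \<subseteq> S" "D \<noteq> {}" "D \<noteq> S" for D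
  proof -
    obtain j i where ij: "j \<in> S - D" "i \<in> D" "q j i > 0" using rates_irreducible[OF D] by blast
    then have "tilted q g j i > 0" by (auto simp: tilted_def)
    then show ?thesis using ij by blast
  qed
qed auto

lemma app_tilted:
  assumes "i \<in> S"
  shows "metzler_matrix.app S (tilted q g) h i = (\<Sum>j\<in>S. q i j * h j) + g i * h i"
proof -
  interpret irreducible_metzler_matrix S "tilted q g" by (rule irreducible_tilted)
  have "app h i = (\<Sum>j\<in>S. q i j * h j + (if i = j then g i * h i else 0))"
    unfolding app_def tilted_def by (intro sum.cong) (auto simp: algebra_simps)
  then show ?thesis using assms by (simp add: sum.distrib)
qed

lemma payoff_survivor:
  "T \<ge> 0 \<Longrightarrow> payoff x {0} F (\<lambda>j. of_bool (j > 0)) T = exp (action x {0} F T) * of_bool (survives x {0} T)"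
  by (auto simp: payoff_def survives_def)

text \<open>A strict supersolution absorbs an extra growth rate \<open>e\<close>, so the expectation decays
  like \<open>exp (- e T)\<close>.\<close>

lemma survivor_payoff_tendsto_0:
  assumes i: "i \<in> S" and w: "\<And>j. j \<in> S \<Longrightarrow> w j > 0"
    and super: "\<And>j. j \<in> S - {0} \<Longrightarrow> (\<Sum>l\<in>S. q j l * w l) + F j * w j < 0"
  shows "(\<lambda>n. LINT \<omega>|P i. payoff (\<lambda>t. X t \<omega>) {0} F (\<lambda>j. of_bool (j > 0)) (real (Suc n))) \<longlonglongrightarrow> 0"
proof -
  define e where "e = Min (insert 1 ((\<lambda>j. - ((\<Sum>l\<in>S. q j l * w l) + F j * w j) / w j) ` (S - {0})))"
  have gap: "- ((\<Sum>l\<in>S. q j l * w l) + F j * w j) / w j > 0" if "j \<in> S - {0}" for j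
    using super[OF that] w[of j] that by (intro divide_pos_pos) auto
  have e: "e > 0"
    unfolding e_def using gap by (subst Min_gr_iff) (auto simp del: minus_add_distrib)
  have super_e: "(\<Sum>l\<in>S. q j l * w l) + (F j + e) * w j \<le> 0" if "j \<in> S - {0}" for j
  proof -
    have "e \<le> - ((\<Sum>l\<in>S. q j l * w l) + F j * w j) / w j"
      unfolding e_def using that by (intro Min_le) auto
    then show ?thesis using w[of j] that by (simp add: field_simps)
  qed
  define m where "m = Min (w ` S)"
  have m: "m > 0" "\<And>j. j \<in> S \<Longrightarrow> m \<le> w j" unfolding m_def using w by auto
  have bound: "(LINT \<omega>|P i. payoff (\<lambda>t. X t \<omega>) {0} F (\<lambda>j. of_bool (j > 0)) T) \<le> w i / m * exp (- e * T)"
    if T: "T > 0" for T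
  proof -
    have "(LINT \<omega>|P i. m * exp (e * T) * payoff (\<lambda>t. X t \<omega>) {0} F (\<lambda>j. of_bool (j > 0)) T) \<le>
        (LINT \<omega>|P i. payoff (\<lambda>t. X t \<omega>) {0} (\<lambda>j. F j + e) w T)"
    proof (rule integral_mono)
      fix \<omega> assume \<omega>: "\<omega> \<in> space (P i)"
      define x where "x t = X t \<omega>" for t
      have xS: "x t \<in> S" if "t \<ge> 0" for t using X_in_S[OF i \<omega> that] by (simp add: x_def)
      have cont: "continuous (at_right t) x" if "t \<ge> 0" for t
        using X_right_continuous[OF i \<omega> that] by (simp add: x_def[abs_def])
      show "m * exp (e * T) * payoff (\<lambda>t. X t \<omega>) {0} F (\<lambda>j. of_bool (j > 0)) T \<le>
          payoff (\<lambda>t. X t \<omega>) {0} (\<lambda>j. F j + e) w T"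
        unfolding x_def[symmetric]
      proof (cases "survives x {0} T")
        case True
        have "action x {0} (\<lambda>j. F j + e) T = action x {0} F T + e * T"
        proof (rule action_add_const[OF _ _ T True])
          show "\<bar>F (x t)\<bar> \<le> (\<Sum>j\<in>S. \<bar>F j\<bar>)" if "t \<ge> 0" for t
            using xS[OF that] by (intro member_le_sum) auto
        qed (rule cont)
        then have "payoff x {0} (\<lambda>j. F j + e) w T = exp (action x {0} F T) * exp (e * T) * w (x T)"
          using True by (simp add: payoff_def exp_add)
        moreover have "exp (action x {0} F T) * exp (e * T) * m \<le> exp (action x {0} F T) * exp (e * T) * w (x T)"
          using m(2)[OF xS[of T]] T by simp
        ultimately show "m * exp (e * T) * payoff x {0} F (\<lambda>j. of_bool (j > 0)) T \<le>
            payoff x {0} (\<lambda>j. F j + e) w T"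
          using T True by (simp add: payoff_survivor mult_ac)
      next
        case False
        then show "m * exp (e * T) * payoff x {0} F (\<lambda>j. of_bool (j > 0)) T \<le>
            payoff x {0} (\<lambda>j. F j + e) w T"
          using T w[of 0] by (simp add: payoff_survivor) (simp add: payoff_def)
      qed
    qed (intro integrable_mult_right payoff_integrable i T)+
    also have "\<dots> \<le> w i"
      by (rule feynman_kac_le[OF i T]) (use super_e in auto)
    finally show ?thesis using m(1) by (simp add: exp_minus field_simps)
  qed
  have "filterlim (\<lambda>x::real. - e * x) at_bot at_top"
    by (rule filterlim_tendsto_neg_mult_at_bot[OF tendsto_const _ filterlim_ident]) (use e in simp)
  then have "((\<lambda>x::real. exp (- e * x)) \<longlongrightarrow> 0) at_top"
    by (rule filterlim_compose[OF exp_at_bot])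
  then have "((\<lambda>x. w i / m * exp (- e * x)) \<longlongrightarrow> w i / m * 0) at_top"
    by (intro tendsto_mult tendsto_const)
  then have "(\<lambda>n. w i / m * exp (- e * real (Suc n))) \<longlonglongrightarrow> w i / m * 0"
    by (rule filterlim_compose[OF _ filterlim_compose[OF filterlim_real_sequentially filterlim_Suc]])
  then have lim: "(\<lambda>n. w i / m * exp (- e * real (Suc n))) \<longlonglongrightarrow> 0"
    by (simp del: of_nat_Suc)
  show ?thesis
  proof (rule tendsto_sandwich[OF _ _ tendsto_const lim])
    show "\<forall>\<^sub>F n in sequentially. 0 \<le> (LINT \<omega>|P i. payoff (\<lambda>t. X t \<omega>) {0} F (\<lambda>j. of_bool (j > 0)) (real (Suc n)))"
      by (intro always_eventually allI Bochner_Integration.integral_nonneg) (simp add: payoff_survivor)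
    show "\<forall>\<^sub>F n in sequentially. (LINT \<omega>|P i. payoff (\<lambda>t. X t \<omega>) {0} F (\<lambda>j. of_bool (j > 0)) (real (Suc n)))
        \<le> w i / m * exp (- e * real (Suc n))"
      by (intro always_eventually allI bound) simp
  qed
qed

lemma strict_supersolution_off_0:
  assumes h: "\<And>i. i \<in> S \<Longrightarrow> h i > 0"
    and eig: "\<And>i. i \<in> S \<Longrightarrow> (\<Sum>j\<in>S. q i j * h j) + F i * h i = 0"
  obtains w where "\<And>i. i \<in> S \<Longrightarrow> w i > 0" "\<And>i. i \<in> S - {0} \<Longrightarrow> (\<Sum>j\<in>S. q i j * w j) + F i * w i < 0"
proof -
  interpret M: irreducible_metzler_matrix S "tilted q F" by (rule irreducible_tilted)
  have "\<exists>w. (\<forall>i\<in>S. w i > 0) \<and> (\<forall>i\<in>S - {0}. M.app w i < 0 * w i)"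
  proof (rule M.strict_supersolution[of "{0}" "{0}" h])
    fix i assume i: "i \<in> S - {0}"
    then have "i \<in> S" by simp
    then show "M.app h i \<le> 0 * h i"
      unfolding app_tilted[OF \<open>i \<in> S\<close>] by (simp only: eig)
  qed (simp_all add: h)
  then obtain w where w: "\<forall>i\<in>S. w i > 0" "\<forall>i\<in>S - {0}. M.app w i < 0 * w i" by (elim exE conjE)
  show ?thesis
  proof (rule that[of w])
    show "w i > 0" if "i \<in> S" for i using w(1) that by blast
    show "(\<Sum>j\<in>S. q i j * w j) + F i * w i < 0" if "i \<in> S - {0}" for i
    proof -
      have "i \<in> S" using that by blast
      then show ?thesis using bspec[OF w(2) that] unfolding app_tilted[OF \<open>i \<in> S\<close>] by simp
    qed
  qed
qed

lemma AE_hits_0: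
  assumes i: "i \<in> S"
  shows "AE \<omega> in P i. \<exists>n. \<not> survives (\<lambda>t. X t \<omega>) {0} (real (Suc n))"
proof -
  interpret prob_space "P i" by (rule prob_space_P[OF i])
  obtain w where w: "\<And>j. j \<in> S \<Longrightarrow> w j > 0" "\<And>j. j \<in> S - {0} \<Longrightarrow> (\<Sum>l\<in>S. q j l * w l) + 0 * w j < 0"
    using strict_supersolution_off_0[of "\<lambda>_. 1" "\<lambda>_. 0"] rate_sum by auto
  define E where "E n = {\<omega> \<in> space (P i). survives (\<lambda>t. X t \<omega>) {0} (real (Suc n))}" for n
  have E: "E n \<in> events" for n
  proof -
    have "(\<lambda>\<omega>. of_bool (survives (\<lambda>t. X t \<omega>) {0} (real (Suc n))) :: real) -` {1} \<inter> space (P i) \<in> events"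
      by (rule measurable_sets[OF measurable_survives[OF i]]) auto
    moreover have "(\<lambda>\<omega>. of_bool (survives (\<lambda>t. X t \<omega>) {0} (real (Suc n))) :: real) -` {1} \<inter> space (P i) = E n"
      by (auto simp: E_def)
    ultimately show ?thesis by simp
  qed
  have "(LINT \<omega>|P i. payoff (\<lambda>t. X t \<omega>) {0} (\<lambda>_. 0) (\<lambda>j. of_bool (j > 0)) (real (Suc n))) = prob (E n)" for n
  proof -
    have "(LINT \<omega>|P i. payoff (\<lambda>t. X t \<omega>) {0} (\<lambda>_. 0) (\<lambda>j. of_bool (j > 0)) (real (Suc n))) =
        (LINT \<omega>|P i. indicator (E n) \<omega>)"
      by (rule Bochner_Integration.integral_cong[OF refl])
         (simp add: payoff_survivor action_def E_def indicator_def del: of_nat_Suc)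
    then show ?thesis using E by simp
  qed
  with survivor_payoff_tendsto_0[where F = "\<lambda>_. 0", OF i w] have lim: "(\<lambda>n. prob (E n)) \<longlonglongrightarrow> 0"
    by simp
  have "(\<Inter>n. E n) \<in> events" using E by (intro sets.countable_INT) auto
  have "prob (\<Inter>n. E n) \<le> prob (E n)" for n
    by (rule finite_measure_mono[OF _ E]) auto
  then have "prob (\<Inter>n. E n) \<le> 0"
    by (intro LIMSEQ_le_const[OF lim]) auto
  then have "prob (\<Inter>n. E n) = 0" by (intro antisym measure_nonneg)
  then have "AE \<omega> in P i. \<omega> \<notin> (\<Inter>n. E n)"
    using prob_eq_0[OF \<open>(\<Inter>n. E n) \<in> events\<close>] by blast
  then show ?thesis
    using AE_space by eventually_elim (auto simp: E_def simp del: of_nat_Suc)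
qed

lemma abs_along_path_le:
  fixes F :: "nat \<Rightarrow> real"
  assumes "i \<in> S" "\<omega> \<in> space (P i)" "t \<ge> 0"
  shows "\<bar>F (X t \<omega>)\<bar> \<le> (\<Sum>j\<in>S. \<bar>F j\<bar>)"
  by (rule member_le_sum[of _ S "\<lambda>j. \<bar>F j\<bar>", OF X_in_S[OF assms]]) auto

lemma rho_eq_eigenvalue:
  assumes \<theta>: "\<theta> > 0" and h: "\<And>i. i \<in> S \<Longrightarrow> h i > 0"
    and eig: "\<And>i. i \<in> S \<Longrightarrow> (\<Sum>j\<in>S. q i j * h j) + \<theta> * c i (v i) * h i = \<mu> * h i"
  shows "rho N \<theta> c P X v = \<mu> / \<theta>"
proof -
  define G where "G j = \<theta> * c j (v j)" for j
  define F where "F j = G j + - \<mu>" for j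
  define m where "m = Min (h ` S)"
  define M where "M = Max (h ` S)"
  have m: "m > 0" "\<And>j. j \<in> S \<Longrightarrow> m \<le> h j" unfolding m_def using h by auto
  have M: "\<And>j. j \<in> S \<Longrightarrow> h j \<le> M" unfolding M_def by auto
  have "M > 0" using h[of 0] M[of 0] by simp
  have lim: "((\<lambda>T. 1 / (\<theta> * T) *
          ln (LINT \<omega>|P i. exp (\<theta> * (LINT t:{0..T}|lborel. c (X t \<omega>) (v (X t \<omega>))))))
        \<longlongrightarrow> \<mu> / \<theta>) at_top" if i: "i \<in> S" for i
  proof (rule log_growth_rate[OF \<theta>])
    show "h i / M > 0" using h[OF i] \<open>M > 0\<close> by simp
    fix T :: real assume T: "T > 0"
    define E where "E \<omega> = exp (\<theta> * (LINT t:{0..T}|lborel. c (X t \<omega>) (v (X t \<omega>))))" for \<omega>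
    define Y where "Y \<omega> = payoff (\<lambda>t. X t \<omega>) {} F h T" for \<omega>
    have E_payoff: "E \<omega> = payoff (\<lambda>t. X t \<omega>) {} G (\<lambda>_. 1) T" for \<omega>
      by (simp add: E_def payoff_def action_def G_def)
    have Y: "Y \<omega> = exp (- \<mu> * T) * E \<omega> * h (X T \<omega>)" if \<omega>: "\<omega> \<in> space (P i)" for \<omega>
    proof -
      have "action (\<lambda>t. X t \<omega>) {} F T = action (\<lambda>t. X t \<omega>) {} G T + - \<mu> * T"
        unfolding F_def
        by (rule action_add_const[OF X_right_continuous[OF i \<omega>] abs_along_path_le[OF i \<omega>] T]) auto
      then show ?thesis by (simp add: Y_def E_payoff payoff_def exp_add[symmetric])
    qed
    have EY: "(LINT \<omega>|P i. Y \<omega>) = h i"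
      unfolding Y_def
    proof (rule feynman_kac_eq[OF i T])
      fix j assume "j \<in> S - {}"
      then show "(\<Sum>l\<in>S. q j l * h l) + F j * h j = 0"
        using eig[of j] by (simp add: F_def G_def algebra_simps)
    qed simp
    have intY: "integrable (P i) Y" and intE: "integrable (P i) E"
      unfolding Y_def E_payoff by (intro payoff_integrable[OF i T])+
    have "exp (- \<mu> * T) * m * (LINT \<omega>|P i. E \<omega>) = (LINT \<omega>|P i. exp (- \<mu> * T) * m * E \<omega>)" by simp
    also have "\<dots> \<le> (LINT \<omega>|P i. Y \<omega>)"
    proof (intro integral_mono integrable_mult_right intE intY)
      fix \<omega> assume \<omega>: "\<omega> \<in> space (P i)"
      have "exp (- \<mu> * T) * E \<omega> * m \<le> exp (- \<mu> * T) * E \<omega> * h (X T \<omega>)"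
        using m(2)[OF X_in_S[OF i \<omega>]] T by (intro mult_left_mono) (auto simp: E_def)
      then show "exp (- \<mu> * T) * m * E \<omega> \<le> Y \<omega>" by (simp add: Y[OF \<omega>] mult_ac)
    qed
    finally have up: "exp (- \<mu> * T) * m * (LINT \<omega>|P i. E \<omega>) \<le> h i" by (simp only: EY)
    have "(LINT \<omega>|P i. Y \<omega>) \<le> (LINT \<omega>|P i. exp (- \<mu> * T) * M * E \<omega>)"
    proof (intro integral_mono integrable_mult_right intE intY)
      fix \<omega> assume \<omega>: "\<omega> \<in> space (P i)"
      have "exp (- \<mu> * T) * E \<omega> * h (X T \<omega>) \<le> exp (- \<mu> * T) * E \<omega> * M"
        using M[OF X_in_S[OF i \<omega>]] T by (intro mult_left_mono) (auto simp: E_def)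
      then show "Y \<omega> \<le> exp (- \<mu> * T) * M * E \<omega>" by (simp add: Y[OF \<omega>] mult_ac)
    qed
    then have low: "h i \<le> exp (- \<mu> * T) * M * (LINT \<omega>|P i. E \<omega>)" by (simp add: EY)
    have exp_inv: "exp (- \<mu> * T) = inverse (exp (\<mu> * T))" by (simp add: exp_minus)
    show "exp (\<mu> * T) * (h i / M) \<le> (LINT \<omega>|P i. exp (\<theta> * (LINT t:{0..T}|lborel. c (X t \<omega>) (v (X t \<omega>))))) \<and>
        (LINT \<omega>|P i. exp (\<theta> * (LINT t:{0..T}|lborel. c (X t \<omega>) (v (X t \<omega>))))) \<le> exp (\<mu> * T) * (h i / m)"
      unfolding E_def[symmetric] using low up m(1) \<open>M > 0\<close> unfolding exp_inv by (simp add: field_simps)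
  qed
  show ?thesis
    unfolding rho_def
  proof (rule the_equality)
    fix r assume "\<forall>i\<in>{0..N}. ((\<lambda>T. 1 / (\<theta> * T) *
          ln (LINT \<omega>|P i. exp (\<theta> * (LINT t:{0..T}|lborel. c (X t \<omega>) (v (X t \<omega>))))))
        \<longlongrightarrow> r) at_top"
    then show "r = \<mu> / \<theta>"
      using tendsto_unique[OF trivial_limit_at_top_linorder _ lim[of 0], of r] by simp
  qed (use lim in blast)
qed

lemma hitting_expectation_eq:
  assumes h: "\<And>i. i \<in> S \<Longrightarrow> h i > 0" and h0: "h 0 = 1"
    and eig: "\<And>i. i \<in> S \<Longrightarrow> (\<Sum>j\<in>S. q i j * h j) + F i * h i = 0"
    and i: "i \<in> S"
  shows "(LINT \<omega>|P i. exp (LINT t:{0..hitting_time0 X \<omega>}|lborel. F (X t \<omega>))) = h i"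
proof -
  define x where "x \<omega> t = X t \<omega>" for \<omega> t
  have cont: "continuous (at_right t) (x \<omega>)" if "\<omega> \<in> space (P i)" "t \<ge> 0" for \<omega> t
    using X_right_continuous[OF i that] by (simp add: x_def[abs_def])
  have bnd: "\<bar>F (x \<omega> t)\<bar> \<le> (\<Sum>j\<in>S. \<bar>F j\<bar>)" if "\<omega> \<in> space (P i)" "t \<ge> 0" for \<omega> t
    unfolding x_def by (rule abs_along_path_le[OF i that])
  define Tn where "Tn n = real (Suc n)" for n
  have Tn: "Tn n > 0" "Tn n \<ge> 0" for n by (simp_all add: Tn_def)
  have Tn_mono: "Tn m \<le> Tn n" if "m \<le> n" for m n using that by (simp add: Tn_def)
  define u where "u \<omega> = exp (LINT t:{0..hitting_time0 X \<omega>}|lborel. F (x \<omega> t))" for \<omega>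
  define V where "V n \<omega> = exp (action (x \<omega>) {0} F (Tn n)) * of_bool (\<not> survives (x \<omega>) {0} (Tn n))" for n \<omega>
  define W where "W n \<omega> = payoff (x \<omega>) {0} F h (Tn n)" for n \<omega>
  define R where "R n \<omega> = payoff (x \<omega>) {0} F (\<lambda>j. if j = 0 then 0 else h j) (Tn n)" for n \<omega>
  define s where "s n \<omega> = payoff (x \<omega>) {0} F (\<lambda>j. of_bool (j > 0)) (Tn n)" for n \<omega>
  have intW: "integrable (P i) (W n)" and intR: "integrable (P i) (R n)" and ints: "integrable (P i) (s n)" for n
    unfolding W_def R_def s_def x_def by (intro payoff_integrable[OF i Tn(1)])+
  have V: "V n \<omega> = W n \<omega> - R n \<omega>" for n \<omega>
  proof (cases "survives (x \<omega>) {0} (Tn n)")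
    case True
    then have "x \<omega> (Tn n) \<noteq> 0" using Tn(2)[of n] by (auto simp: survives_def)
    then show ?thesis using True by (simp add: V_def W_def R_def payoff_def)
  qed (simp add: V_def W_def R_def payoff_def h0)
  have intV: "integrable (P i) (V n)" for n
    unfolding V[abs_def] by (intro Bochner_Integration.integrable_diff intW intR)
  have EW: "(LINT \<omega>|P i. W n \<omega>) = h i" for n
    unfolding W_def x_def by (rule feynman_kac_eq[OF i Tn(1)]) (use eig in auto)
  define M where "M = Max (h ` S)"
  have M: "h j \<le> M" if "j \<in> S" for j unfolding M_def using that by auto
  obtain w where w: "\<And>j. j \<in> S \<Longrightarrow> w j > 0" "\<And>j. j \<in> S - {0} \<Longrightarrow> (\<Sum>l\<in>S. q j l * w l) + F j * w j < 0"
    using strict_supersolution_off_0[OF h eig] by blast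
  have lim_s: "(\<lambda>n. LINT \<omega>|P i. s n \<omega>) \<longlonglongrightarrow> 0"
    using survivor_payoff_tendsto_0[where F = F, OF i w] by (simp add: s_def x_def[abs_def] Tn_def del: of_nat_Suc)
  have R_bound: "0 \<le> R n \<omega> \<and> R n \<omega> \<le> M * s n \<omega>" if \<omega>: "\<omega> \<in> space (P i)" for n \<omega>
  proof (cases "survives (x \<omega>) {0} (Tn n)")
    case True
    then have ne: "x \<omega> (Tn n) \<noteq> 0" using Tn(2)[of n] by (auto simp: survives_def)
    have "x \<omega> (Tn n) \<in> S" unfolding x_def by (rule X_in_S[OF i \<omega> Tn(2)])
    then show ?thesis using True ne h[of "x \<omega> (Tn n)"] M[of "x \<omega> (Tn n)"]
      by (simp add: R_def s_def payoff_def)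
  qed (simp add: R_def s_def payoff_def)
  have "(\<lambda>n. LINT \<omega>|P i. R n \<omega>) \<longlonglongrightarrow> 0"
  proof (rule tendsto_sandwich[OF _ _ tendsto_const])
    show "(\<lambda>n. M * (LINT \<omega>|P i. s n \<omega>)) \<longlonglongrightarrow> 0"
      using tendsto_mult[OF tendsto_const[of M] lim_s] by simp
    show "\<forall>\<^sub>F n in sequentially. 0 \<le> (LINT \<omega>|P i. R n \<omega>)"
      using R_bound by (intro always_eventually allI integral_nonneg_AE AE_I2) auto
    show "\<forall>\<^sub>F n in sequentially. (LINT \<omega>|P i. R n \<omega>) \<le> M * (LINT \<omega>|P i. s n \<omega>)"
    proof (intro always_eventually allI)
      fix n
      have "(LINT \<omega>|P i. R n \<omega>) \<le> (LINT \<omega>|P i. M * s n \<omega>)"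
        by (intro integral_mono integrable_mult_right intR ints) (use R_bound in auto)
      then show "(LINT \<omega>|P i. R n \<omega>) \<le> M * (LINT \<omega>|P i. s n \<omega>)" by simp
    qed
  qed
  from tendsto_diff[OF tendsto_const[of "h i"] this]
  have lim_EV: "(\<lambda>n. LINT \<omega>|P i. V n \<omega>) \<longlonglongrightarrow> h i"
    by (simp add: V Bochner_Integration.integral_diff[OF intW intR] EW)
  have V_mono: "V m \<omega> \<le> V n \<omega>" if "m \<le> n" for m n \<omega>
  proof (cases "survives (x \<omega>) {0} (Tn m)")
    case False
    then have "\<not> survives (x \<omega>) {0} (Tn n)" using survives_mono Tn_mono[OF that] by blast
    then show ?thesis using action_after_death[OF False Tn_mono[OF that]] by (simp add: V_def)
  qed (simp add: V_def)
  have ever: "\<forall>\<^sub>F n in sequentially. \<not> survives (x \<omega>) {0} (Tn n)" if "\<not> survives (x \<omega>) {0} (Tn m)" for m \<omega>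
    using eventually_ge_at_top[of m] by eventually_elim (use that survives_mono Tn_mono in blast)
  have hit_V: "V n \<omega> = u \<omega>" if \<omega>: "\<omega> \<in> space (P i)" and dead: "\<not> survives (x \<omega>) {0} (Tn n)" for n \<omega>
  proof -
    have "{t. t > 0 \<and> x \<omega> t = 0} \<noteq> {}"
    proof -
      obtain r where r: "r \<ge> 0" "x \<omega> r = 0" using dead by (auto simp: survives_def)
      obtain e where e: "e > 0" "\<And>t. r \<le> t \<Longrightarrow> t < r + e \<Longrightarrow> x \<omega> t = x \<omega> r"
      proof (rule right_continuous_nat_stays[OF cont[OF \<omega> r(1)]])
        fix e :: real assume "e > 0" "\<And>t. r \<le> t \<Longrightarrow> t < r + e \<Longrightarrow> x \<omega> t = x \<omega> r"
        then show thesis by (rule that)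
      qed
      have "r + e / 2 \<in> {t. t > 0 \<and> x \<omega> t = 0}" using r e(1) e(2)[of "r + e / 2"] by simp
      then show ?thesis by blast
    qed
    from action_eq_hitting_time_integral[where x = "x \<omega>" and F = F, OF cont[OF \<omega>] bnd[OF \<omega>] this Tn(1) dead]
    have "action (x \<omega>) {0} F (Tn n) = (LINT t:{0..hitting_time0 X \<omega>}|lborel. F (x \<omega> t))"
      by (simp add: hitting_time0_def x_def)
    then show ?thesis using dead by (simp add: V_def u_def)
  qed
  \<comment> \<open>The junk value of the hitting time on the null event that \<open>0\<close> is not hit; it matters only for
    the measurability of \<open>u\<close>.\<close>
  define a0 :: real where "a0 = Inf {}"
  define C where "C \<omega> = exp (LINT t:{0..a0}|lborel. F (x \<omega> t))" for \<omega>
  have C_meas: "C \<in> borel_measurable (P i)"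
  proof (cases "a0 > 0")
    case True
    have "(\<lambda>\<omega>. exp (action (\<lambda>t. X t \<omega>) {} F a0)) \<in> borel_measurable (P i)"
      by (rule measurable_compose[OF measurable_action[OF i True] borel_measurable_exp])
    then show ?thesis by (simp add: C_def[abs_def] action_def x_def)
  next
    case False
    have "(LINT t:{0..a0}|lborel. F (x \<omega> t)) = (LINT t:{}|lborel. F (x \<omega> t))" for \<omega>
    proof (cases "a0 = 0")
      case True
      show ?thesis
        unfolding set_lebesgue_integral_def True
      proof -
        have "(LINT t|lborel. indicator {0..0} t *\<^sub>R F (x \<omega> t)) = (LINT t|lborel. indicator {0::real} t * F (x \<omega> 0))"
          by (rule Bochner_Integration.integral_cong[OF refl]) (auto simp: indicator_def)
        then show "(LINT t|lborel. indicator {0..0} t *\<^sub>R F (x \<omega> t)) = (LINT t|lborel. indicator {} t *\<^sub>R F (x \<omega> t))"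
          by simp
      qed
    qed (use False in simp)
    then show ?thesis by (simp add: C_def[abs_def] set_lebesgue_integral_def)
  qed
  have u_meas: "u \<in> borel_measurable (P i)"
  proof (rule borel_measurable_LIMSEQ_real)
    show "(\<lambda>\<omega>. of_bool (survives (x \<omega>) {0} (Tn n)) * C \<omega> + V n \<omega>) \<in> borel_measurable (P i)" for n
      using C_meas measurable_survives[OF i Tn(1), of "{0}" n] borel_measurable_integrable[OF intV]
      by (intro borel_measurable_add borel_measurable_times) (auto simp: x_def[abs_def])
    fix \<omega> assume \<omega>: "\<omega> \<in> space (P i)"
    have "\<forall>\<^sub>F n in sequentially. of_bool (survives (x \<omega>) {0} (Tn n)) * C \<omega> + V n \<omega> = u \<omega>"
    proof (cases "\<exists>m. \<not> survives (x \<omega>) {0} (Tn m)")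
      case True
      then obtain m where "\<not> survives (x \<omega>) {0} (Tn m)" by blast
      from ever[OF this] show ?thesis by eventually_elim (simp add: hit_V[OF \<omega>])
    next
      case False
      have "{t. t > 0 \<and> X t \<omega> = 0} = {}"
      proof (rule ccontr)
        assume "{t. t > 0 \<and> X t \<omega> = 0} \<noteq> {}"
        then obtain t where t: "t > 0" "x \<omega> t = 0" by (auto simp: x_def)
        obtain n where "t \<le> real n" using real_arch_simple[of t] by blast
        then have "t \<in> {0..Tn n}" using t by (simp add: Tn_def)
        then have "\<not> survives (x \<omega>) {0} (Tn n)" using t by (auto simp: survives_def)
        then show False using False by blast
      qed
      then have "u \<omega> = C \<omega>" unfolding u_def C_def a0_def hitting_time0_def by (rule arg_cong)
      then show ?thesis using False by (simp add: V_def)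
    qed
    then show "(\<lambda>n. of_bool (survives (x \<omega>) {0} (Tn n)) * C \<omega> + V n \<omega>) \<longlonglongrightarrow> u \<omega>"
      by (rule tendsto_eventually)
  qed
  have "AE \<omega> in P i. (\<lambda>n. V n \<omega>) \<longlonglongrightarrow> u \<omega>"
    using AE_hits_0[OF i] AE_space
  proof eventually_elim
    case (elim \<omega>)
    then obtain m where "\<not> survives (x \<omega>) {0} (Tn m)" by (auto simp: x_def[abs_def] Tn_def simp del: of_nat_Suc)
    from ever[OF this] have "\<forall>\<^sub>F n in sequentially. V n \<omega> = u \<omega>"
      by eventually_elim (rule hit_V[OF elim(2)])
    then show ?case by (rule tendsto_eventually)
  qed
  moreover have "AE \<omega> in P i. mono (\<lambda>n. V n \<omega>)" by (intro AE_I2 monoI V_mono)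
  moreover have "AE \<omega> in P i. 0 \<le> V n \<omega>" for n by (simp add: V_def)
  ultimately have "(LINT \<omega>|P i. u \<omega>) = h i"
    by (intro integral_monotone_convergence_nonneg(2)[OF intV _ _ _ lim_EV u_meas])
  then show ?thesis by (simp add: u_def x_def)
qed

lemma hfun_eq_eigenvector:
  assumes \<theta>: "\<theta> > 0" and h: "\<And>i. i \<in> S \<Longrightarrow> h i > 0" and h0: "h 0 = 1"
    and eig: "\<And>i. i \<in> S \<Longrightarrow> (\<Sum>j\<in>S. q i j * h j) + \<theta> * c i (v i) * h i = \<mu> * h i"
    and i: "i \<in> S"
  shows "hfun N \<theta> c P X v i = h i"
proof -
  define r where "r = rho N \<theta> c P X v"
  have \<mu>: "\<mu> = \<theta> * r" using rho_eq_eigenvalue[where h = h and c = c and v = v and \<mu> = \<mu>, OF \<theta> h eig] \<theta> by (simp add: r_def)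
  have "(LINT \<omega>|P i. exp (LINT t:{0..hitting_time0 X \<omega>}|lborel. \<theta> * (c (X t \<omega>) (v (X t \<omega>)) - r))) = h i"
  proof (rule hitting_expectation_eq[where F = "\<lambda>j. \<theta> * (c j (v j) - r)" and h = h, OF h h0 _ i])
    fix j assume "j \<in> S"
    from eig[OF this] show "(\<Sum>l\<in>S. q j l * h l) + \<theta> * (c j (v j) - r) * h j = 0"
      by (simp add: \<mu> algebra_simps)
  qed
  then show ?thesis by (simp add: hfun_def r_def)
qed

end

section \<open>Policy improvement\<close>

theorem theorem5p1:
  fixes N :: nat
    and U :: "nat \<Rightarrow> 'u set"
    and rate :: "nat \<Rightarrow> nat \<Rightarrow> 'u \<Rightarrow> real"
    and c :: "nat \<Rightarrow> 'u \<Rightarrow> real"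
    and \<theta> :: real
    and P :: "(nat \<Rightarrow> 'u) \<Rightarrow> nat \<Rightarrow> 'w measure"
    and X :: "real \<Rightarrow> 'w \<Rightarrow> nat"
    and u :: "nat \<Rightarrow> nat \<Rightarrow> 'u"
  assumes actions: "\<And>i. i \<in> {0..N} \<Longrightarrow> finite (U i) \<and> U i \<noteq> {}"
    and rate_nonneg:
      "\<And>i j a. i \<in> {0..N} \<Longrightarrow> j \<in> {0..N} \<Longrightarrow> j \<noteq> i \<Longrightarrow> a \<in> U i \<Longrightarrow> rate i j a \<ge> 0"
    and rate_diag:
      "\<And>i a. i \<in> {0..N} \<Longrightarrow> a \<in> U i \<Longrightarrow> rate i i a = - (\<Sum>j\<in>{0..N} - {i}. rate i j a)"
    and cost_nonneg: "\<And>i a. i \<in> {0..N} \<Longrightarrow> a \<in> U i \<Longrightarrow> c i a \<ge> 0"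
    and theta: "0 < \<theta>" "\<theta> < 1"
    and chain: "\<And>v. v \<in> stationary_controls N U \<Longrightarrow>
      markov_chain {0..N} (\<lambda>i j. rate i j (v i)) (P v) X"
    and irreducible: "\<And>v. v \<in> stationary_controls N U \<Longrightarrow> irreducible_chain {0..N} (P v) X"
    and controls: "\<And>n. n \<ge> 1 \<Longrightarrow> u n \<in> stationary_controls N U"
    and improvement: "\<And>n i. n \<ge> 1 \<Longrightarrow> i \<in> {0..N} \<Longrightarrow>
      is_arg_min
        (\<lambda>a. \<theta> * c i a * hfun N \<theta> c (P (u n)) X (u n) i
           + (\<Sum>j\<in>{0..N}. rate i j a * hfun N \<theta> c (P (u n)) X (u n) j))
        (\<lambda>a. a \<in> U i) (u (Suc n) i)"
  shows "\<exists>n\<ge>1. rho N \<theta> c (P (u n)) X (u n) =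
    (INF v\<in>stationary_controls N U. rho N \<theta> c (P v) X v)"
proof -
  define C where "C = stationary_controls N U"
  have controlD: "v i \<in> U i" if "v \<in> C" "i \<in> {0..N}" for v i
    using that by (auto simp: C_def stationary_controls_def)
  define g where "g v j = \<theta> * c j (v j)" for v j
  have chain': "irreducible_jump_chain N (\<lambda>i j. rate i j (v i)) (P v) X" if v: "v \<in> C" for v
    using chain[of v] irreducible[of v] rate_nonneg rate_diag controlD[OF v] v
    by unfold_locales (auto simp: C_def)
  define A where "A v = metzler_matrix.app {0..N} (tilted (\<lambda>i j. rate i j (v i)) (g v))" for v
  have matrix: "irreducible_metzler_matrix {0..N} (tilted (\<lambda>i j. rate i j (v i)) (g v))"
    if "v \<in> C" for v
    by (rule irreducible_jump_chain.irreducible_tilted[OF chain'[OF that]])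
  have A: "A v h i = \<theta> * c i (v i) * h i + (\<Sum>j\<in>{0..N}. rate i j (v i) * h j)"
    if "v \<in> C" "i \<in> {0..N}" for v h i
    unfolding A_def using irreducible_jump_chain.app_tilted[OF chain'[OF that(1)] that(2)] by (simp add: g_def)
  have "\<exists>\<mu> h. h 0 = 1 \<and> (\<forall>i\<in>{0..N}. h i > 0) \<and> (\<forall>i\<in>{0..N}. A v h i = \<mu> * h i)" if v: "v \<in> C" for v
  proof (rule irreducible_metzler_matrix.perron_eigenvector[OF matrix[OF v], of 0])
    fix \<mu> h
    assume "h 0 = 1" "\<And>i. i \<in> {0..N} \<Longrightarrow> h i > 0"
      "\<And>i. i \<in> {0..N} \<Longrightarrow> metzler_matrix.app {0..N} (tilted (\<lambda>i j. rate i j (v i)) (g v)) h i = \<mu> * h i"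
    then show ?thesis unfolding A_def by blast
  qed simp
  then obtain \<mu> h where h0: "\<And>v. v \<in> C \<Longrightarrow> h v 0 = 1"
    and h: "\<And>v i. v \<in> C \<Longrightarrow> i \<in> {0..N} \<Longrightarrow> h v i > 0"
    and eig: "\<And>v i. v \<in> C \<Longrightarrow> i \<in> {0..N} \<Longrightarrow> A v (h v) i = \<mu> v * h v i"
    by metis
  have rho: "rho N \<theta> c (P v) X v = \<mu> v / \<theta>" if v: "v \<in> C" for v
  proof (rule irreducible_jump_chain.rho_eq_eigenvalue[OF chain'[OF v] theta(1), of "h v"])
    show "(\<Sum>j = 0..N. rate i j (v i) * h v j) + \<theta> * c i (v i) * h v i = \<mu> v * h v i" if "i \<in> {0..N}" for i
      using eig[OF v that] A[OF v that] by simp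
  qed (use h v in auto)
  have hfun: "hfun N \<theta> c (P v) X v i = h v i" if v: "v \<in> C" and i: "i \<in> {0..N}" for v i
  proof (rule irreducible_jump_chain.hfun_eq_eigenvector[OF chain'[OF v] theta(1), of "h v", OF _ _ _ i])
    show "(\<Sum>j = 0..N. rate i j (v i) * h v j) + \<theta> * c i (v i) * h v i = \<mu> v * h v i" if "i \<in> {0..N}" for i
      using eig[OF v that] A[OF v that] by simp
  qed (use h h0 v in auto)
  have uC: "u n \<in> C" if "n \<ge> 1" for n using controls[OF that] by (simp add: C_def)
  have greedy: "A (u (Suc n)) (h (u n)) i \<le> A v (h (u n)) i"
    if n: "n \<ge> 1" and i: "i \<in> {0..N}" and v: "v \<in> C" for n i v
  proof -
    have "(\<Sum>j\<in>{0..N}. rate i j a * hfun N \<theta> c (P (u n)) X (u n) j) =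
        (\<Sum>j\<in>{0..N}. rate i j a * h (u n) j)" for a
      by (intro sum.cong refl) (simp add: hfun[OF uC[OF n]])
    then have "is_arg_min (\<lambda>a. \<theta> * c i a * h (u n) i + (\<Sum>j\<in>{0..N}. rate i j a * h (u n) j))
        (\<lambda>a. a \<in> U i) (u (Suc n) i)"
      using improvement[OF n i] by (simp add: hfun[OF uC[OF n] i])
    then show ?thesis
      using controlD[OF v i] uC[of "Suc n"] v i by (simp add: is_arg_min_linorder A)
  qed
  have improve: "\<mu> (u (Suc n)) < \<mu> (u n) \<or> (\<forall>v\<in>C. \<mu> (u n) \<le> \<mu> v)" if n: "n \<ge> 1" for n
  proof -
    note un = uC[OF n]
    have un': "u (Suc n) \<in> C" by (rule uC) simp
    interpret M: irreducible_metzler_matrix "{0..N}"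
      "tilted (\<lambda>i j. rate i j (u (Suc n) i)) (g (u (Suc n)))"
      by (rule matrix[OF un'])
    have le: "A (u (Suc n)) (h (u n)) i \<le> \<mu> (u n) * h (u n) i" if i: "i \<in> {0..N}" for i
      using greedy[OF n i un] eig[OF un i] by simp
    show ?thesis
    proof (cases "\<exists>i\<in>{0..N}. A (u (Suc n)) (h (u n)) i < \<mu> (u n) * h (u n) i")
      case True
      then obtain i where i: "i \<in> {0..N}" "A (u (Suc n)) (h (u n)) i < \<mu> (u n) * h (u n) i" by blast
      have "\<exists>w. (\<forall>i\<in>{0..N}. w i > 0) \<and> (\<forall>i\<in>{0..N} - {}. M.app w i < \<mu> (u n) * w i)"
        by (rule M.strict_supersolution[of "{i}" "{}" "h (u n)"]) (use i le h[OF un] in \<open>auto simp: A_def\<close>)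
      then obtain w where w: "\<And>i. i \<in> {0..N} \<Longrightarrow> w i > 0" "\<And>i. i \<in> {0..N} \<Longrightarrow> M.app w i < \<mu> (u n) * w i"
        by (metis Diff_empty)
      have "\<mu> (u (Suc n)) < \<mu> (u n)"
        by (rule M.subsolution_less_supersolution[of "h (u (Suc n))" w])
          (use w h[OF un'] eig[OF un'] in \<open>auto simp: A_def\<close>)
      then show ?thesis ..
    next
      case False
      have "\<mu> (u n) \<le> \<mu> v" if v: "v \<in> C" for v
      proof -
        interpret V: irreducible_metzler_matrix "{0..N}"
          "tilted (\<lambda>i j. rate i j (v i)) (g v)"
          by (rule matrix[OF v])
        show ?thesis
        proof (rule V.subsolution_le_supersolution[of "h (u n)" "h v"])
          fix i assume i: "i \<in> {0..N}"
          show "\<mu> (u n) * h (u n) i \<le> V.app (h (u n)) i"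
            using False greedy[OF n i v] i by (force simp: A_def)
          show "V.app (h v) i \<le> \<mu> v * h v i" using eig[OF v i] by (simp add: A_def)
        qed (use h un v in auto)
      qed
      then show ?thesis by blast
    qed
  qed
  have "finite C"
    unfolding C_def stationary_controls_def using actions by (intro finite_PiE) auto
  obtain n where n: "n \<ge> 1" "\<forall>v\<in>C. \<mu> (u n) \<le> \<mu> v"
  proof (rule ccontr)
    assume "\<not> thesis"
    then have dec: "\<mu> (u (Suc n)) < \<mu> (u n)" if "n \<ge> 1" for n
      using improve[OF that] that \<open>\<And>n. 1 \<le> n \<Longrightarrow> \<forall>v\<in>C. \<mu> (u n) \<le> \<mu> v \<Longrightarrow> thesis\<close> by blast
    have "strict_mono (\<lambda>n. - \<mu> (u (Suc n)))"
      using dec by (intro strict_mono_Suc_iff[THEN iffD2]) simp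
    then have "inj (\<lambda>n. - \<mu> (u (Suc n)))" by (rule strict_mono_imp_inj_on)
    then have "infinite (range (\<lambda>n. - \<mu> (u (Suc n))))" by (simp add: finite_image_iff)
    moreover have "range (\<lambda>n. - \<mu> (u (Suc n))) \<subseteq> (\<lambda>v. - \<mu> v) ` C" using uC by auto
    ultimately show False using \<open>finite C\<close> finite_subset by blast
  qed
  have "(INF v\<in>C. rho N \<theta> c (P v) X v) = rho N \<theta> c (P (u n)) X (u n)"
    using n uC[OF n(1)] theta by (intro cInf_eq_minimum) (auto simp: rho divide_right_mono)
  then show ?thesis using n(1) by (auto simp: C_def)
qed

end
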